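(* Let $\rho_1,\rho_2,\rho_3,k,b,m,\delta,\beta,\tau>0$ be constants and let $g:[0,\infty)\to\mathbb{R}$ be a differentiable kernel, not identically zero, such that: $g\ge 0$; there are constants $k_1,k_2>0$ with $-k_1g(s)\le g'(s)\le -k_2g(s)$ for all $s\ge0$; and $a:=b-b_0>0$, where $b_0:=\int_0^\infty g(s)\,ds$. Put $$\chi_{0,\tau}=\Big(\tau-\frac{\rho_1}{\rho_3k}\Big)\Big(\rho_2-\frac{b\rho_1}{k}\Big)-\frac{\tau\rho_1\delta^2}{\rho_3k}.$$ Then there exist constants $C,\lambda>0$ such that for every $\xi\in\mathbb{R}$, every solution $(\hat v,\hat u,\hat z,\hat y,\hat\theta,\hat q,\hat\eta)$ of the Fourier-transformed Timoshenko–Cattaneo system (given in the context) at frequency $\xi$, and every $t\ge0$, $$\hat E(\xi,t)\le C e^{-\lambda\rho(\xi)t}\hat E(\xi,0),$$ where $$\hat E(\xi,t)=\rho_1|\hat u|^2+\rho_2|\hat y|^2+\rho_3|\hat\theta|^2+k|\hat v|^2+a|\hat z|^2+\tau|\hat q|^2+m\xi^2\int_0^\infty g(s)|\hat\eta(s)|^2ds$$ and $$\rho(\xi)=\begin{cases}\dfrac{\xi^4}{(1+\xi^2)^3}&\text{if }\chi_{0,\tau}=0,\\[2mm] \dfrac{\xi^4}{(1+\xi^2)^4}&\text{if }\chi_{0,\tau}\neq0.\end{cases}$$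
   Context: Fourier-transformed Timoshenko–Cattaneo system with history at frequency $\xi\in\mathbb{R}$: complex-valued unknowns $\hat v,\hat u,\hat z,\hat y,\hat\theta,\hat q$ depending on $t\ge 0$ and $\hat\eta=\hat\eta(t,s)$ depending on $t\ge0$, $s\ge0$, with $$\begin{aligned} &\hat v_t-i\xi\hat u+\hat y=0,\qquad \rho_1\hat u_t-ik\xi\hat v=0,\qquad \hat z_t-i\xi\hat y=0,\\ &\rho_2\hat y_t-ia\xi\hat z+m\xi^2\int_0^\infty g(s)\hat\eta(s)\,ds-k\hat v+i\delta\xi\hat\theta=0,\\ &\rho_3\hat\theta_t+i\xi\hat q+i\delta\xi\hat y=0,\qquad \tau\hat q_t+\beta\hat q+i\xi\hat\theta=0,\\ &\hat\eta_t+\hat\eta_s-\hat y=0,\qquad \hat\eta(t,0)=0. \end{aligned}$$ A solution is understood to be sufficiently regular and of finite energy ($\int_0^\infty g|\hat\eta|^2ds<\infty$). *)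

theory Defs
  imports "HOL-Analysis.Analysis"
begin

text \<open>
  The Fourier-transformed Timoshenko--Cattaneo system with history, at a fixed frequency \<open>\<xi>\<close>.
  Only the values at times \<open>t \<ge> 0\<close> and at history variables \<open>s \<ge> 0\<close> matter; time derivatives
  at \<open>t = 0\<close> are one-sided.

  Regularity: the six functions of time are differentiable on \<open>[0, \<infinity>)\<close>. The history variable
  \<open>\<eta>\<close> is continuous on the closed quarter plane and differentiable, as a function of the two
  variables \<open>(t, s)\<close>, except possibly on the characteristic \<open>s = t\<close> issuing from the corner.
  Differentiability on that line would force the compatibility condition
  \<open>\<eta>\<^sub>s(0,0) = y(0)\<close> on the initial data (since \<open>\<eta>(t,0) = 0\<close>); for
  \<open>\<eta>(t,s) = \<psi>(t) - \<psi>(t - s)\<close> with \<open>\<psi>\<^sub>t = y\<close> it would force the prescribed past of \<open>\<psi>\<close> to join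
  the solution at time \<open>0\<close> without a jump of velocity. Solutions that are differentiable
  everywhere are included.
\<close>

definition timoshenko_cattaneo_solution ::
  "real \<Rightarrow> real \<Rightarrow> real \<Rightarrow> real \<Rightarrow> real \<Rightarrow> real \<Rightarrow> real \<Rightarrow> real \<Rightarrow> real \<Rightarrow> (real \<Rightarrow> real) \<Rightarrow> real \<Rightarrow>
   (real \<Rightarrow> complex) \<Rightarrow> (real \<Rightarrow> complex) \<Rightarrow> (real \<Rightarrow> complex) \<Rightarrow> (real \<Rightarrow> complex) \<Rightarrow>
   (real \<Rightarrow> complex) \<Rightarrow> (real \<Rightarrow> complex) \<Rightarrow> (real \<Rightarrow> real \<Rightarrow> complex) \<Rightarrow> bool" where
  "timoshenko_cattaneo_solution \<rho>\<^sub>1 \<rho>\<^sub>2 \<rho>\<^sub>3 k a m \<delta> \<beta> \<tau> g \<xi> v u z y \<theta> q \<eta> \<longleftrightarrow>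
     (\<forall>t\<ge>0. \<exists>v\<^sub>t u\<^sub>t z\<^sub>t y\<^sub>t \<theta>\<^sub>t q\<^sub>t.
        (v has_vector_derivative v\<^sub>t) (at t within {0..}) \<and>
        (u has_vector_derivative u\<^sub>t) (at t within {0..}) \<and>
        (z has_vector_derivative z\<^sub>t) (at t within {0..}) \<and>
        (y has_vector_derivative y\<^sub>t) (at t within {0..}) \<and>
        (\<theta> has_vector_derivative \<theta>\<^sub>t) (at t within {0..}) \<and>
        (q has_vector_derivative q\<^sub>t) (at t within {0..}) \<and>
        v\<^sub>t - \<i> * of_real \<xi> * u t + y t = 0 \<and>
        of_real \<rho>\<^sub>1 * u\<^sub>t - \<i> * of_real k * of_real \<xi> * v t = 0 \<and>
        z\<^sub>t - \<i> * of_real \<xi> * y t = 0 \<and>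
        of_real \<rho>\<^sub>2 * y\<^sub>t - \<i> * of_real a * of_real \<xi> * z t
          + of_real m * (of_real \<xi>)\<^sup>2 * (LINT s:{0..}|lborel. of_real (g s) * \<eta> t s)
          - of_real k * v t + \<i> * of_real \<delta> * of_real \<xi> * \<theta> t = 0 \<and>
        of_real \<rho>\<^sub>3 * \<theta>\<^sub>t + \<i> * of_real \<xi> * q t + \<i> * of_real \<delta> * of_real \<xi> * y t = 0 \<and>
        of_real \<tau> * q\<^sub>t + of_real \<beta> * q t + \<i> * of_real \<xi> * \<theta> t = 0) \<and>
     continuous_on ({0..} \<times> {0..}) (\<lambda>(t, s). \<eta> t s) \<and>
     (\<forall>t\<ge>0. \<forall>s\<ge>0. s \<noteq> t \<longrightarrow>
        (\<exists>\<eta>\<^sub>t \<eta>\<^sub>s.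
           ((\<lambda>(t, s). \<eta> t s) has_derivative (\<lambda>(dt, ds). dt *\<^sub>R \<eta>\<^sub>t + ds *\<^sub>R \<eta>\<^sub>s))
             (at (t, s) within {0..} \<times> {0..}) \<and>
           \<eta>\<^sub>t + \<eta>\<^sub>s - y t = 0)) \<and>
     (\<forall>t\<ge>0. \<eta> t 0 = 0) \<and>
     (\<forall>t\<ge>0. set_integrable lborel {0..} (\<lambda>s. g s * (cmod (\<eta> t s))\<^sup>2))"

definition timoshenko_cattaneo_energy ::
  "real \<Rightarrow> real \<Rightarrow> real \<Rightarrow> real \<Rightarrow> real \<Rightarrow> real \<Rightarrow> real \<Rightarrow> (real \<Rightarrow> real) \<Rightarrow> real \<Rightarrow>
   (real \<Rightarrow> complex) \<Rightarrow> (real \<Rightarrow> complex) \<Rightarrow> (real \<Rightarrow> complex) \<Rightarrow> (real \<Rightarrow> complex) \<Rightarrow>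
   (real \<Rightarrow> complex) \<Rightarrow> (real \<Rightarrow> complex) \<Rightarrow> (real \<Rightarrow> real \<Rightarrow> complex) \<Rightarrow> real \<Rightarrow> real" where
  "timoshenko_cattaneo_energy \<rho>\<^sub>1 \<rho>\<^sub>2 \<rho>\<^sub>3 k a m \<tau> g \<xi> v u z y \<theta> q \<eta> t =
     \<rho>\<^sub>1 * (cmod (u t))\<^sup>2 + \<rho>\<^sub>2 * (cmod (y t))\<^sup>2 + \<rho>\<^sub>3 * (cmod (\<theta> t))\<^sup>2 + k * (cmod (v t))\<^sup>2
     + a * (cmod (z t))\<^sup>2 + \<tau> * (cmod (q t))\<^sup>2
     + m * \<xi>\<^sup>2 * (LINT s:{0..}|lborel. g s * (cmod (\<eta> t s))\<^sup>2)"

definition stability_number ::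
  "real \<Rightarrow> real \<Rightarrow> real \<Rightarrow> real \<Rightarrow> real \<Rightarrow> real \<Rightarrow> real \<Rightarrow> real" where
  "stability_number \<rho>\<^sub>1 \<rho>\<^sub>2 \<rho>\<^sub>3 k b \<delta> \<tau> =
     (\<tau> - \<rho>\<^sub>1 / (\<rho>\<^sub>3 * k)) * (\<rho>\<^sub>2 - b * \<rho>\<^sub>1 / k) - \<tau> * \<rho>\<^sub>1 * \<delta>\<^sup>2 / (\<rho>\<^sub>3 * k)"

definition decay_rate :: "real \<Rightarrow> real \<Rightarrow> real" where
  "decay_rate \<chi>\<^sub>0 \<xi> = (if \<chi>\<^sub>0 = 0 then \<xi> ^ 4 / (1 + \<xi>\<^sup>2) ^ 3 else \<xi> ^ 4 / (1 + \<xi>\<^sup>2) ^ 4)"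

end

theory Submission
  imports Defs
begin

text \<open>
  Along characteristics \<open>\<eta>(t,s) = Y(t) - \<psi>(t - s)\<close> with \<open>Y\<^sub>t = y\<close>, so the memory terms
  \<open>\<mu> = \<integral>g \<eta>\<close> and \<open>N = \<integral>g |\<eta>|\<^sup>2\<close> reduce to convolutions of the kernel with continuous functions.
  This shows that they are differentiable, although \<open>\<eta>\<^sub>s\<close> itself need not be integrable, with
  \<open>\<mu>' = b\<^sub>0 y + R\<close>, where \<open>|R|\<^sup>2 \<le> k\<^sub>1\<^sup>2 b\<^sub>0 N\<close>, and \<open>N' \<le> 2 Re (y\<^sup>* \<mu>) - k\<^sub>2 N\<close>.

  Hence the energy dissipates \<open>q\<close> and \<open>\<xi>\<^sup>2 N\<close>. With \<open>\<sigma> = (1 + \<xi>\<^sup>2)\<^sup>-\<^sup>1\<^sup>/\<^sup>2\<close> and \<open>p = |\<xi>| \<sigma>\<close>, five further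
  multipliers, each bounded by the energy, dissipate \<open>p \<theta>\<close>, \<open>p y\<close>, \<open>p \<sigma> v\<close>, \<open>p\<^sup>2 \<sigma> u\<close> and \<open>p\<^sup>2 z\<close>, up to errors
  that can be absorbed successively. The weakest weight \<open>(p\<^sup>2 \<sigma>)\<^sup>2 = \<xi>\<^sup>4 / (1 + \<xi>\<^sup>2)\<^sup>3\<close> is the decay rate
  obtained, whatever the stability number; it dominates the rate \<open>\<xi>\<^sup>4 / (1 + \<xi>\<^sup>2)\<^sup>4\<close>.
\<close>

section \<open>Differentiation of integrals and of quadratic expressions\<close>

text \<open>Formally the derivatives of the memory terms come from integrating
  \<open>\<eta>\<^sub>s\<close> by parts. Finite energy bounds only the \<open>g\<close>-weighted
  square of \<open>\<eta>\<close>, so the substitution \<open>r = t - s\<close> is used instead: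
  time then sits in the kernel alone, the derivative falls on \<open>g\<close>, and
  \<open>\<bar>g'\<bar> \<le> k\<^sub>1 * g\<close> dominates the difference quotients.

  The frequency weights are dictated by the couplings. Since \<open>\<mu>' = b\<^sub>0 y + R\<close>
  carries no factor \<xi>, pairing \<open>y\<close> with \<open>\<mu>\<close> controls
  \<open>y\<close> directly. The coupling of \<open>y\<close> with \<open>u\<close> that arises when
  \<open>v\<close> is estimated has the weight
  \<open>p^2 \<sigma>^2 |\<xi>| = (p^2 \<sigma>) p\<close>, exactly the weight of \<open>u\<close>
  times that of \<open>y\<close>; hence it can be absorbed, whatever its coefficient
  \<open>a \<rho>\<^sub>1 - k \<rho>\<^sub>2\<close>.

  All constants have to be uniform in \<xi>. Powers of \<open>\<sigma>\<close> turn each factor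
  \<open>|\<xi>|\<close> into \<open>p\<close>, which is at most 1, so low and high frequencies are
  treated at once.\<close>

lemma has_vector_derivative_within_iff_quotient:
  fixes f :: "real \<Rightarrow> 'b::real_normed_vector"
  shows "(f has_vector_derivative D) (at t within S) \<longleftrightarrow>
    ((\<lambda>u. (f u - f t) /\<^sub>R (u - t)) \<longlongrightarrow> D) (at t within S)"
proof -
  have "(f has_vector_derivative D) (at t within S) \<longleftrightarrow>
      ((\<lambda>u. (f u - f t - (u - t) *\<^sub>R D) /\<^sub>R norm (u - t)) \<longlongrightarrow> 0) (at t within S)"
    by (simp add: has_vector_derivative_def has_derivative_at_within bounded_linear_scaleR_left
        diff_diff_eq)
  also have "\<dots> \<longleftrightarrow> ((\<lambda>u. (f u - f t) /\<^sub>R (u - t) - D) \<longlongrightarrow> 0) (at t within S)"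
  proof -
    have "norm ((f u - f t - (u - t) *\<^sub>R D) /\<^sub>R norm (u - t)) = norm ((f u - f t) /\<^sub>R (u - t) - D)"
      if "u \<noteq> t" for u
    proof -
      have "(f u - f t) /\<^sub>R (u - t) - D = (f u - f t - (u - t) *\<^sub>R D) /\<^sub>R (u - t)"
        using that by (simp add: scaleR_diff_right)
      then show ?thesis by simp
    qed
    then have "eventually (\<lambda>u. norm ((f u - f t - (u - t) *\<^sub>R D) /\<^sub>R norm (u - t))
        = norm ((f u - f t) /\<^sub>R (u - t) - D)) (at t within S)"
      by (auto simp: eventually_at_filter)
    from tendsto_cong[OF this, of 0] show ?thesis
      by (simp only: tendsto_norm_zero_iff)
  qed
  finally show ?thesis by (simp add: LIM_zero_iff)
qed

text \<open>Dominated convergence for the difference quotients along an arbitrary sequence tending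
  to \<open>t\<close>. The Lipschitz bound compares with the base point \<open>t\<close> alone, and
  the derivative may fail on a null set: a translated kernel has a corner there.\<close>

lemma has_vector_derivative_integral_dominated:
  fixes K :: "real \<Rightarrow> 'a \<Rightarrow> 'b::{banach, second_countable_topology}"
  assumes t: "t \<in> S"
    and int: "\<And>u. u \<in> S \<Longrightarrow> integrable M (K u)"
    and meas: "K' \<in> borel_measurable M"
    and w: "integrable M w"
    and lip: "\<And>u x. u \<in> S \<Longrightarrow> norm (K u x - K t x) \<le> \<bar>u - t\<bar> * w x"
    and der: "AE x in M. ((\<lambda>u. K u x) has_vector_derivative K' x) (at t within S)"
  shows "((\<lambda>u. \<integral>x. K u x \<partial>M) has_vector_derivative (\<integral>x. K' x \<partial>M)) (at t within S)"
  unfolding has_vector_derivative_within_iff_quotient tendsto_at_iff_sequentially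
proof safe
  fix X :: "nat \<Rightarrow> real"
  assume XS: "\<forall>i. X i \<in> S - {t}" and X: "X \<longlonglongrightarrow> t"
  have intq: "integrable M (\<lambda>x. (K (X i) x - K t x) /\<^sub>R (X i - t))" for i
    using XS int t by auto
  have "(\<lambda>i. \<integral>x. (K (X i) x - K t x) /\<^sub>R (X i - t) \<partial>M) \<longlonglongrightarrow> (\<integral>x. K' x \<partial>M)"
  proof (rule integral_dominated_convergence[where w = w])
    show "AE x in M. norm ((K (X i) x - K t x) /\<^sub>R (X i - t)) \<le> w x" for i
    proof (rule AE_I2)
      fix x
      have "inverse \<bar>X i - t\<bar> * norm (K (X i) x - K t x) \<le> inverse \<bar>X i - t\<bar> * (\<bar>X i - t\<bar> * w x)"
        using lip[of "X i" x] XS by (intro mult_left_mono) auto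
      also have "\<dots> = w x" using XS by (simp add: mult.assoc[symmetric])
      finally show "norm ((K (X i) x - K t x) /\<^sub>R (X i - t)) \<le> w x" by simp
    qed
    show "AE x in M. (\<lambda>i. (K (X i) x - K t x) /\<^sub>R (X i - t)) \<longlonglongrightarrow> K' x"
      using der
    proof eventually_elim
      case (elim x)
      with XS X show ?case
        unfolding has_vector_derivative_within_iff_quotient tendsto_at_iff_sequentially
        by (auto simp: o_def)
    qed
  qed (use meas w intq in auto)
  moreover have "(\<integral>x. (K (X i) x - K t x) /\<^sub>R (X i - t) \<partial>M)
      = ((\<integral>x. K (X i) x \<partial>M) - (\<integral>x. K t x \<partial>M)) /\<^sub>R (X i - t)" for i
    using XS int t by simp
  ultimately show "((\<lambda>u. ((\<integral>x. K u x \<partial>M) - (\<integral>x. K t x \<partial>M)) /\<^sub>R (u - t)) \<circ> X) \<longlonglongrightarrow> (\<integral>x. K' x \<partial>M)"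
    by (simp only: o_def)
qed

text \<open>Gronwall's argument: \<open>exp (r * s) * f s\<close> is nonincreasing. The signs of
  \<open>r\<close> and \<open>f\<close> are free, so the kernel, its negative and the Lyapunov
  functional are all covered.\<close>

lemma exp_decay_of_deriv_le:
  fixes f :: "real \<Rightarrow> real"
  assumes der: "\<And>t. 0 \<le> t \<Longrightarrow> \<exists>d. (f has_real_derivative d) (at t within {0..}) \<and> d \<le> - r * f t"
    and t: "0 \<le> t"
  shows "f t \<le> f 0 * exp (- r * t)"
proof -
  define h where "h s = exp (r * s) * f s" for s
  have hd: "\<exists>d\<le>0. (h has_real_derivative d) (at s within {0..})" if s: "0 \<le> s" for s
  proof -
    obtain d where d: "(f has_real_derivative d) (at s within {0..})" "d \<le> - r * f s"
      using der[OF s] by blast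
    have "((\<lambda>s. exp (r * s)) has_real_derivative r * exp (r * s)) (at s within {0..})"
      by (auto intro!: derivative_eq_intros)
    from DERIV_mult[OF this d(1)]
    have "(h has_real_derivative exp (r * s) * (r * f s + d)) (at s within {0..})"
      by (simp add: h_def[abs_def] algebra_simps)
    moreover have "exp (r * s) * (r * f s + d) \<le> 0"
      using d(2) by (intro mult_nonneg_nonpos) auto
    ultimately show ?thesis by blast
  qed
  have "h t \<le> h 0"
  proof (rule DERIV_nonpos_imp_decreasing_open[OF t, of h])
    show "\<exists>y. (h has_real_derivative y) (at s) \<and> y \<le> 0" if "0 < s" "s < t" for s
      using hd[of s] that at_within_interior[of s "{0..}"] by auto
    have "continuous_on {0..} h"
      using hd DERIV_continuous by (fastforce simp: continuous_on_eq_continuous_within)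
    then show "continuous_on {0..t} h"
      by (rule continuous_on_subset) auto
  qed
  then have "exp (- (r * t)) * (exp (r * t) * f t) \<le> exp (- (r * t)) * f 0"
    by (intro mult_left_mono) (auto simp: h_def)
  moreover have "exp (- (r * t)) * (exp (r * t) * f t) = f t"
    by (simp add: mult.assoc[symmetric] exp_add[symmetric])
  ultimately have "f t \<le> exp (- (r * t)) * f 0" by (simp only:)
  then show ?thesis by (simp add: mult.commute)
qed

lemma exp_set_integrable:
  assumes "0 < (c::real)"
  shows "set_integrable lborel {0..} (\<lambda>s. exp (- c * s))" "(LINT s:{0..}|lborel. exp (- c * s)) = 1 / c"
proof -
  have i: "((\<lambda>x. exp (- c * x)) has_integral exp (-c * 0)/c) {0..}"
    by (rule has_integral_exp_minus_to_infinity[OF assms])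
  then have *: "set_integrable lebesgue {0..} (\<lambda>s. exp (- c * s))"
    by (intro absolutely_integrable_onI nonnegative_absolutely_integrable_1[unfolded atomize_imp]) (auto simp: integrable_on_def)
  show 1: "set_integrable lborel {0..} (\<lambda>s. exp (- c * s))"
    using * unfolding set_integrable_def
    by (subst integrable_completion[symmetric]) auto
  show "(LINT s:{0..}|lborel. exp (- c * s)) = 1 / c"
    using set_borel_integral_eq_integral(2)[OF 1] i by (simp add: integral_unique)
qed

text \<open>Expand the square. The weight may be negative, because the identity serves both the
  kernel and its derivative.\<close>

lemma weighted_square_integral:
  fixes h :: "'a \<Rightarrow> real" and f :: "'a \<Rightarrow> complex"
  assumes "integrable M h" "integrable M (\<lambda>x. h x *\<^sub>R f x)" "integrable M (\<lambda>x. h x * (cmod (f x))\<^sup>2)"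
  shows "integrable M (\<lambda>x. h x * (cmod (c - f x))\<^sup>2)"
    and "(\<integral>x. h x * (cmod (c - f x))\<^sup>2 \<partial>M) = (cmod c)\<^sup>2 * (\<integral>x. h x \<partial>M)
      - 2 * Re (cnj c * (\<integral>x. h x *\<^sub>R f x \<partial>M)) + (\<integral>x. h x * (cmod (f x))\<^sup>2 \<partial>M)"
proof -
  have eq: "h x * (cmod (c - f x))\<^sup>2 = (cmod c)\<^sup>2 * h x - 2 * Re (cnj c * (h x *\<^sub>R f x)) + h x * (cmod (f x))\<^sup>2" for x
    unfolding cmod_power2 by (simp add: power2_eq_square algebra_simps)
  have i: "integrable M (\<lambda>x. Re (cnj c * (h x *\<^sub>R f x)))"
    by (intro integrable_Re integrable_mult_right assms)
  show "integrable M (\<lambda>x. h x * (cmod (c - f x))\<^sup>2)"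
    unfolding eq by (intro Bochner_Integration.integrable_add Bochner_Integration.integrable_diff integrable_mult_right i assms)
  have "(\<integral>x. h x * (cmod (c - f x))\<^sup>2 \<partial>M) = (\<integral>x. (cmod c)\<^sup>2 * h x \<partial>M) - (\<integral>x. 2 * Re (cnj c * (h x *\<^sub>R f x)) \<partial>M)
      + (\<integral>x. h x * (cmod (f x))\<^sup>2 \<partial>M)"
    unfolding eq using i assms
    by (simp only: Bochner_Integration.integral_add Bochner_Integration.integral_diff
        Bochner_Integration.integrable_diff integrable_mult_right)
  also have "(\<integral>x. 2 * Re (cnj c * (h x *\<^sub>R f x)) \<partial>M) = 2 * Re (\<integral>x. cnj c * (h x *\<^sub>R f x) \<partial>M)"
    using integral_Re[OF integrable_mult_right[OF assms(2), of "cnj c"]]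
    by (simp only: integral_mult_right_zero)
  finally show "(\<integral>x. h x * (cmod (c - f x))\<^sup>2 \<partial>M) = (cmod c)\<^sup>2 * (\<integral>x. h x \<partial>M)
      - 2 * Re (cnj c * (\<integral>x. h x *\<^sub>R f x \<partial>M)) + (\<integral>x. h x * (cmod (f x))\<^sup>2 \<partial>M)"
    by (simp only: integral_mult_right_zero)
qed

text \<open>The variance about the weighted mean \<open>I / H\<close> is nonnegative.\<close>

lemma weighted_Cauchy_Schwarz:
  fixes h :: "'a \<Rightarrow> real" and f :: "'a \<Rightarrow> complex"
  assumes "integrable M h" "integrable M (\<lambda>x. h x *\<^sub>R f x)" "integrable M (\<lambda>x. h x * (cmod (f x))\<^sup>2)"
    and h: "\<And>x. 0 \<le> h x" and pos: "0 < (\<integral>x. h x \<partial>M)"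
  shows "(cmod (\<integral>x. h x *\<^sub>R f x \<partial>M))\<^sup>2 \<le> (\<integral>x. h x \<partial>M) * (\<integral>x. h x * (cmod (f x))\<^sup>2 \<partial>M)"
proof -
  define H I where "H = (\<integral>x. h x \<partial>M)" and "I = (\<integral>x. h x *\<^sub>R f x \<partial>M)"
  have "0 \<le> (\<integral>x. h x * (cmod (I / H - f x))\<^sup>2 \<partial>M)"
    by (rule Bochner_Integration.integral_nonneg) (use h in auto)
  also have "\<dots> = (cmod (I / H))\<^sup>2 * H - 2 * Re (cnj (I / H) * I) + (\<integral>x. h x * (cmod (f x))\<^sup>2 \<partial>M)"
    unfolding H_def I_def by (rule weighted_square_integral(2)[OF assms(1-3)])
  also have "Re (cnj (I / H) * I) = (cmod I)\<^sup>2 / H"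
    unfolding cmod_power2 by (simp add: power2_eq_square add_divide_distrib)
  also have "(cmod (I / H))\<^sup>2 * H = (cmod I)\<^sup>2 / H"
    using pos by (simp add: H_def norm_divide power2_eq_square)
  finally show ?thesis using pos by (simp add: H_def I_def field_simps)
qed

lemma has_real_derivative_Re_mult_cnj:
  assumes "(f has_vector_derivative f') (at t within S)" "(h has_vector_derivative h') (at t within S)"
  shows "((\<lambda>t. Re (f t * cnj (h t))) has_real_derivative Re (f' * cnj (h t) + f t * cnj h')) (at t within S)"
  unfolding has_real_derivative_iff_has_vector_derivative
  using bounded_linear.has_vector_derivative[OF bounded_linear_Re
      has_vector_derivative_mult[OF assms(1) bounded_linear.has_vector_derivative[OF bounded_linear_cnj assms(2)]]]
  by (simp add: add.commute)

lemma has_real_derivative_Im_mult_cnj: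
  assumes "(f has_vector_derivative f') (at t within S)" "(h has_vector_derivative h') (at t within S)"
  shows "((\<lambda>t. Im (f t * cnj (h t))) has_real_derivative Im (f' * cnj (h t) + f t * cnj h')) (at t within S)"
  unfolding has_real_derivative_iff_has_vector_derivative
  using bounded_linear.has_vector_derivative[OF bounded_linear_Im
      has_vector_derivative_mult[OF assms(1) bounded_linear.has_vector_derivative[OF bounded_linear_cnj assms(2)]]]
  by (simp add: add.commute)

lemma has_real_derivative_cmod_power2:
  assumes "(f has_vector_derivative f') (at t within S)"
  shows "((\<lambda>t. (cmod (f t))\<^sup>2) has_real_derivative 2 * Re (f' * cnj (f t))) (at t within S)"
proof -
  have "(\<lambda>t. (cmod (f t))\<^sup>2) = (\<lambda>t. Re (f t * cnj (f t)))"
    unfolding cmod_power2 by (simp add: power2_eq_square)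
  moreover have "2 * Re (f' * cnj (f t)) = Re (f' * cnj (f t) + f t * cnj f')"
    by simp
  ultimately show ?thesis
    using has_real_derivative_Re_mult_cnj[OF assms assms] by (simp only:)
qed

text \<open>On a line \<open>s = t + c\<close> the difference of \<open>\<eta>\<close> and
  \<open>Y\<close> has derivative \<open>\<eta>\<^sub>t + \<eta>\<^sub>s - y = 0\<close>. The line
  enters the quarter plane through the initial data if \<open>c > 0\<close> and through the boundary
  if \<open>c < 0\<close>; these cases are the two branches of \<open>\<psi>\<close>, which match at
  0 because \<open>\<eta> 0 0\<close> and \<open>Y 0\<close> both vanish.\<close>

lemma transport_characteristics:
  fixes \<eta> :: "real \<Rightarrow> real \<Rightarrow> complex" and y Y :: "real \<Rightarrow> complex"
  assumes cont: "continuous_on ({0..} \<times> {0..}) (\<lambda>(t, s). \<eta> t s)"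
    and transport: "\<And>t s. 0 \<le> t \<Longrightarrow> 0 \<le> s \<Longrightarrow> s \<noteq> t \<Longrightarrow> \<exists>\<eta>\<^sub>t \<eta>\<^sub>s.
      ((\<lambda>(t, s). \<eta> t s) has_derivative (\<lambda>(dt, ds). dt *\<^sub>R \<eta>\<^sub>t + ds *\<^sub>R \<eta>\<^sub>s)) (at (t, s) within {0..} \<times> {0..}) \<and>
      \<eta>\<^sub>t + \<eta>\<^sub>s - y t = 0"
    and bd: "\<And>t. 0 \<le> t \<Longrightarrow> \<eta> t 0 = 0"
    and Y: "\<And>t. 0 \<le> t \<Longrightarrow> (Y has_vector_derivative y t) (at t within {0..})" "Y 0 = 0"
    and \<psi>_def: "\<psi> = (\<lambda>r. if 0 \<le> r then Y r else - \<eta> 0 (- r))"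
  shows "continuous_on UNIV \<psi>"
    and "\<And>t s. 0 \<le> t \<Longrightarrow> 0 \<le> s \<Longrightarrow> \<eta> t s = Y t - \<psi> (t - s)"
proof -
  have cont_s: "continuous_on {0..} (\<eta> t)" if "0 \<le> t" for t
  proof -
    have "continuous_on {0..} (\<lambda>s. (t, s))" by (intro continuous_intros)
    from continuous_on_compose2[OF cont this] that show ?thesis by force
  qed
  show cont_\<psi>: "continuous_on UNIV \<psi>"
  proof -
    have "continuous_on ({0..} \<union> {..0}) \<psi>"
      unfolding \<psi>_def
    proof (rule continuous_on_If)
      show "continuous_on {0..} Y"
        using Y(1) by (intro continuous_on_vector_derivative[of _ _ y]) auto
      show "continuous_on {..0} (\<lambda>r. - \<eta> 0 (- r))"
        by (intro continuous_intros continuous_on_compose2[OF cont_s[of 0]]) auto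
    qed (use bd[of 0] Y(2) in auto)
    moreover have "{0..} \<union> {..0} = (UNIV :: real set)" by auto
    ultimately show ?thesis by simp
  qed
  have off_diag: "\<eta> t (t + c) = Y t - \<psi> (- c)" if "c \<noteq> 0" "0 \<le> t" "0 \<le> t + c" for t c
  proof -
    \<comment> \<open>\<open>max 0 (- c)\<close> is the time at which the line
      \<open>s = t + c\<close> enters the quarter plane; the constant is read off there.\<close>
    define S where "S = {max 0 (- c)..}"
    have "((\<lambda>u. \<eta> u (u + c) - Y u) has_vector_derivative 0) (at u within S)" if u: "u \<in> S" for u
    proof -
      obtain \<eta>\<^sub>t \<eta>\<^sub>s where d: "((\<lambda>(t, s). \<eta> t s) has_derivative (\<lambda>(dt, ds). dt *\<^sub>R \<eta>\<^sub>t + ds *\<^sub>R \<eta>\<^sub>s)) (at (u, u + c) within {0..} \<times> {0..})"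
        and e: "\<eta>\<^sub>t + \<eta>\<^sub>s - y u = 0"
        using transport[of u "u + c"] u \<open>c \<noteq> 0\<close> by (auto simp: S_def)
      have d1: "((\<lambda>u. (u, u + c)) has_derivative (\<lambda>h. (h, h))) (at u within S)"
        by (auto intro!: derivative_eq_intros)
      have d2: "((\<lambda>(t, s). \<eta> t s) has_derivative (\<lambda>(dt, ds). dt *\<^sub>R \<eta>\<^sub>t + ds *\<^sub>R \<eta>\<^sub>s)) (at (u, u + c) within (\<lambda>u. (u, u + c)) ` S)"
        by (rule has_derivative_subset[OF d]) (auto simp: S_def)
      have "((\<lambda>u. \<eta> u (u + c)) has_derivative (\<lambda>h. h *\<^sub>R (\<eta>\<^sub>t + \<eta>\<^sub>s))) (at u within S)"
        using has_derivative_in_compose[OF d1 d2] by (simp add: scaleR_add_right)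
      then have "((\<lambda>u. \<eta> u (u + c)) has_vector_derivative y u) (at u within S)"
        using e by (simp add: has_vector_derivative_def)
      moreover have "(Y has_vector_derivative y u) (at u within S)"
        by (rule has_vector_derivative_within_subset[OF Y(1)]) (use u in \<open>auto simp: S_def\<close>)
      ultimately show ?thesis
        using has_vector_derivative_diff by fastforce
    qed
    then obtain d where d: "\<And>u. u \<in> S \<Longrightarrow> \<eta> u (u + c) - Y u = d"
      using has_vector_derivative_zero_constant[of S "\<lambda>u. \<eta> u (u + c) - Y u"] by (auto simp: S_def)
    have "\<eta> t (t + c) - Y t = d" using that by (intro d) (auto simp: S_def)
    moreover have "d = - \<psi> (- c)"
      using d[of "max 0 (- c)"] bd[of "- c"] Y(2) \<open>c \<noteq> 0\<close>
      by (cases "0 < c") (auto simp: S_def \<psi>_def)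
    ultimately show ?thesis by (simp add: algebra_simps)
  qed
  show "\<eta> t s = Y t - \<psi> (t - s)" if t: "0 \<le> t" "0 \<le> s" for t s
  proof (cases "s = t")
    case False
    then show ?thesis using off_diag[of "s - t" t] that by simp
  next
    case True
    \<comment> \<open>On the diagonal the formula is the limit of the one on the nearby
      characteristics, by continuity of \<open>\<eta> t\<close> and \<open>\<psi>\<close>.\<close>
    have l: "(\<lambda>n. t + 1 / Suc n) \<longlonglongrightarrow> t"
      using tendsto_add[OF tendsto_const[of t] lim_1_over_n[THEN LIMSEQ_Suc]] by simp
    have lim1: "(\<lambda>n. \<eta> t (t + 1 / Suc n)) \<longlonglongrightarrow> \<eta> t t"
      using t by (intro continuous_on_tendsto_compose[OF cont_s[OF t(1)] l]) (auto intro!: always_eventually add_nonneg_nonneg)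
    have lim2: "(\<lambda>n. Y t - \<psi> (t - (t + 1 / Suc n))) \<longlonglongrightarrow> Y t - \<psi> (t - t)"
      by (intro tendsto_intros continuous_on_tendsto_compose[OF cont_\<psi>] l) auto
    have "\<eta> t (t + 1 / Suc n) = Y t - \<psi> (t - (t + 1 / Suc n))" for n
      using off_diag[of "1 / Suc n" t] t by (simp add: add_nonneg_nonneg)
    with lim2 have "(\<lambda>n. \<eta> t (t + 1 / Suc n)) \<longlonglongrightarrow> Y t - \<psi> (t - t)" by (simp only:)
    from LIMSEQ_unique[OF lim1 this] True show ?thesis by simp
  qed
qed

section \<open>Convolution with the memory kernel\<close>

locale memory_kernel =
  fixes g g' :: "real \<Rightarrow> real" and k\<^sub>1 k\<^sub>2 :: real
  assumes deriv: "\<And>s. 0 \<le> s \<Longrightarrow> (g has_real_derivative g' s) (at s within {0..})"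
    and nonneg: "\<And>s. 0 \<le> s \<Longrightarrow> 0 \<le> g s"
    and nontrivial: "\<exists>s\<ge>0. g s \<noteq> 0"
    and k\<^sub>1_pos: "0 < k\<^sub>1" and k\<^sub>2_pos: "0 < k\<^sub>2"
    and deriv_ge: "\<And>s. 0 \<le> s \<Longrightarrow> - k\<^sub>1 * g s \<le> g' s"
    and deriv_le: "\<And>s. 0 \<le> s \<Longrightarrow> g' s \<le> - k\<^sub>2 * g s"
begin

lemma continuous: "continuous_on {0..} g"
  by (rule DERIV_continuous_on) (use deriv in auto)

lemma abs_deriv_le: "0 \<le> s \<Longrightarrow> \<bar>g' s\<bar> \<le> k\<^sub>1 * g s"
  using deriv_ge[of s] deriv_le[of s] nonneg[of s] k\<^sub>1_pos k\<^sub>2_pos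
  by (smt (verit, best) mult_minus_left mult_nonneg_nonneg)

lemma mvt:
  assumes "0 \<le> s" "s < u"
  obtains x where "s < x" "x < u" "g u - g s = (u - s) * g' x"
proof -
  have "\<exists>x\<in>{s<..<u}. g u - g s = (\<lambda>y. y * g' x) (u - s)"
  proof (rule mvt_simple[OF assms(2)])
    show "(g has_derivative (\<lambda>y. y * g' x)) (at x within {s..u})" if "s \<le> x" "x \<le> u" for x
      using DERIV_subset[OF deriv[of x], of "{s..u}"] assms that
      by (auto simp: has_field_derivative_def mult.commute[of _ "g' x"])
  qed
  then show ?thesis using that by auto
qed

lemma antimono: "0 \<le> s \<Longrightarrow> s \<le> u \<Longrightarrow> g u \<le> g s"
proof (cases "s < u")
  case True
  assume "0 \<le> s"
  from mvt[OF this True] obtain x where x: "s < x" "x < u" "g u - g s = (u - s) * g' x" .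
  have "g' x \<le> 0"
    using deriv_le[of x] nonneg[of x] k\<^sub>2_pos x \<open>0 \<le> s\<close> by (smt (verit) mult_nonneg_nonneg mult_minus_left)
  then have "(u - s) * g' x \<le> 0" using True by (simp add: mult_nonneg_nonpos)
  with x show ?thesis by linarith
qed auto

text \<open>Mean value theorem with \<open>\<bar>g'\<bar> \<le> k\<^sub>1 * g\<close>, evaluated at
  the left end because \<open>g\<close> decreases. A Lipschitz constant proportional to
  \<open>g\<close> itself is what lets \<open>g\<close>-weighted integrability dominate difference
  quotients.\<close>

lemma lipschitz:
  assumes "0 \<le> s" "s \<le> u"
  shows "\<bar>g u - g s\<bar> \<le> \<bar>u - s\<bar> * (k\<^sub>1 * g s)"
proof (cases "s < u")
  case True
  from mvt[OF assms(1) True] obtain x where x: "s < x" "x < u" "g u - g s = (u - s) * g' x" .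
  have "\<bar>g' x\<bar> \<le> k\<^sub>1 * g s"
    using abs_deriv_le[of x] antimono[of s x] x assms k\<^sub>1_pos
    by (smt (verit) mult_left_mono)
  then show ?thesis using x by (simp add: abs_mult mult_left_mono)
next
  case False
  with assms have "s = u" by simp
  then show ?thesis by simp
qed

text \<open>Gronwall for \<open>g\<close> and for \<open>- g\<close>. The upper bound makes
  \<open>g\<close> integrable, the lower one makes its integral positive.\<close>

lemma exp_bounds:
  assumes "0 \<le> s"
  shows "g s \<le> g 0 * exp (- k\<^sub>2 * s)" "g 0 * exp (- k\<^sub>1 * s) \<le> g s"
proof -
  show "g s \<le> g 0 * exp (- k\<^sub>2 * s)"
    by (rule exp_decay_of_deriv_le[OF _ assms]) (use deriv deriv_le in blast)
  have "- g s \<le> - g 0 * exp (- k\<^sub>1 * s)"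
  proof (rule exp_decay_of_deriv_le[OF _ assms])
    show "\<exists>d. ((\<lambda>s. - g s) has_real_derivative d) (at t within {0..}) \<and> d \<le> - k\<^sub>1 * - g t"
      if "0 \<le> t" for t
      using DERIV_minus[OF deriv[OF that]] deriv_ge[OF that] by (intro exI[of _ "- g' t"]) simp
  qed
  then show "g 0 * exp (- k\<^sub>1 * s) \<le> g s" by simp
qed

lemma g0_pos: "0 < g 0"
proof (rule ccontr)
  assume "\<not> 0 < g 0"
  then have "g 0 = 0" using nonneg[of 0] by simp
  moreover obtain s where "0 \<le> s" "g s \<noteq> 0" using nontrivial by blast
  ultimately show False using exp_bounds(1)[of s] nonneg[of s] by simp
qed

lemma measurable_on_nonneg: "(\<lambda>s. indicator {0..} s * g s) \<in> borel_measurable borel"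
  using borel_measurable_continuous_on_indicator[OF _ continuous] by simp

lemma set_integrable: "set_integrable lborel {0..} g"
proof -
  have "set_integrable lborel {0..} (\<lambda>s. g 0 * exp (- k\<^sub>2 * s))"
    using exp_set_integrable(1)[OF k\<^sub>2_pos] by auto
  then show ?thesis
    by (rule set_integrable_bound)
      (use measurable_on_nonneg exp_bounds(1) nonneg in \<open>auto simp: set_borel_measurable_def\<close>)
qed

lemma integral_pos: "0 < (LINT s:{0..}|lborel. g s)"
proof -
  have "0 < g 0 * (1 / k\<^sub>1)" using g0_pos k\<^sub>1_pos by simp
  also have "\<dots> = (LINT s:{0..}|lborel. g 0 * exp (- k\<^sub>1 * s))"
    using exp_set_integrable(2)[OF k\<^sub>1_pos] by simp
  also have "\<dots> \<le> (LINT s:{0..}|lborel. g s)"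
    by (rule set_integral_mono) (use exp_set_integrable(1)[OF k\<^sub>1_pos] set_integrable exp_bounds(2) in auto)
  finally show ?thesis .
qed

text \<open>A pointwise derivative need not be continuous, so it is written as a limit of difference
  quotients of a measurable function. The forward steps \<open>1 / Suc n\<close> stay in the
  half-line even at \<open>s = 0\<close>.\<close>

lemma deriv_measurable: "(\<lambda>s. indicator {0..} s * g' s) \<in> borel_measurable borel"
proof (rule borel_measurable_LIMSEQ_real)
  define G where "G s = indicator {0..} s * g s" for s
  have [measurable]: "G \<in> borel_measurable borel"
    using measurable_on_nonneg by (simp add: G_def[abs_def])
  show "(\<lambda>s. indicator {0..} s * ((G (s + 1 / Suc n) - G s) / (1 / Suc n))) \<in> borel_measurable borel" for n
    by measurable
  show "(\<lambda>n. indicator {0..} s * ((G (s + 1 / Suc n) - G s) / (1 / Suc n))) \<longlonglongrightarrow> indicator {0..} s * g' s" for s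
  proof (cases "0 \<le> s")
    case True
    have "((\<lambda>u. (g u - g s) / (u - s)) \<longlongrightarrow> g' s) (at s within {0..})"
      using deriv[OF True] by (simp add: has_field_derivative_iff)
    moreover have "(\<lambda>n. s + 1 / Suc n) \<longlonglongrightarrow> s"
      using tendsto_add[OF tendsto_const[of s] lim_1_over_n[THEN LIMSEQ_Suc]] by simp
    ultimately have "((\<lambda>u. (g u - g s) / (u - s)) \<circ> (\<lambda>n. s + 1 / Suc n)) \<longlonglongrightarrow> g' s"
      using True unfolding tendsto_at_iff_sequentially
      by (auto simp del: of_nat_Suc intro: add_nonneg_nonneg)
    then show ?thesis using True by (simp add: o_def G_def add_nonneg_nonneg)
  qed simp
qed

text \<open>One constant for a whole half-line: \<open>c = - r\<close> serves the past
  \<open>r < 0\<close>, and \<open>c = 0\<close> the times after 0.\<close>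

lemma lipschitz_beyond:
  assumes "0 \<le> c" "c \<le> s" "c \<le> u"
  shows "\<bar>g u - g s\<bar> \<le> \<bar>u - s\<bar> * (k\<^sub>1 * g c)"
proof -
  have *: "\<bar>g y - g x\<bar> \<le> \<bar>y - x\<bar> * (k\<^sub>1 * g c)" if "c \<le> x" "x \<le> y" for x y
  proof -
    have "\<bar>y - x\<bar> * (k\<^sub>1 * g x) \<le> \<bar>y - x\<bar> * (k\<^sub>1 * g c)"
      using antimono[of c x] that assms(1) k\<^sub>1_pos by (intro mult_left_mono) auto
    with lipschitz[of x y] that assms(1) show ?thesis by linarith
  qed
  show ?thesis
    using *[of s u] *[of u s] assms by (cases "s \<le> u") (auto simp: abs_minus_commute)
qed

text \<open>Substituting \<open>r = t - s\<close> moves the time dependence from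
  \<open>\<psi>\<close>, known to be continuous, to the kernel. The cut-off kernel \<open>G\<close>
  jumps by \<open>g 0\<close> at the origin, which produces the term
  \<open>g 0 *\<^sub>R \<psi> t\<close>; the rest is differentiated under the integral.\<close>

lemma memory_integral:
  fixes \<psi> :: "real \<Rightarrow> 'b::euclidean_space"
  assumes cont: "continuous_on UNIV \<psi>"
    and past: "set_integrable lborel {0..} (\<lambda>s. g s * norm (\<psi> (- s)))"
    and t: "0 \<le> t"
  shows memory_integrable: "set_integrable lborel {0..} (\<lambda>s. g s *\<^sub>R \<psi> (t - s))"
    and memory_deriv_integrable: "set_integrable lborel {0..} (\<lambda>s. g' s *\<^sub>R \<psi> (t - s))"
    and memory_has_vector_derivative:
      "((\<lambda>u. LINT s:{0..}|lborel. g s *\<^sub>R \<psi> (u - s)) has_vector_derivative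
        g 0 *\<^sub>R \<psi> t + (LINT s:{0..}|lborel. g' s *\<^sub>R \<psi> (t - s))) (at t within {0..})"
proof -
  define G where "G s = indicator {0..} s * g s" for s
  define G' where "G' s = indicator {0..} s * g' s" for s
  \<comment> \<open>A common majorant: for \<open>r < 0\<close> monotonicity gives
    \<open>g (u - r) \<le> g (- r)\<close>, integrable against \<open>\<psi>\<close> by
    \<open>past\<close>; on \<open>{0..T}\<close> the kernel is at most \<open>g 0\<close> and
    \<open>\<psi>\<close> is continuous on a compact interval.\<close>
  define W where "W T r = indicator {..<0} r * (G (- r) * norm (\<psi> r))
    + indicator {0..T} r * (g 0 * norm (\<psi> r))" for T r
  have [measurable]: "G \<in> borel_measurable borel" "G' \<in> borel_measurable borel"
    using measurable_on_nonneg deriv_measurable by (simp_all add: G_def[abs_def] G'_def[abs_def])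
  have [measurable]: "\<psi> \<in> borel_measurable borel"
    using cont by (rule borel_measurable_continuous_onI)
  have W_int: "integrable lborel (W T)" for T
    unfolding W_def
  proof (rule Bochner_Integration.integrable_add)
    have "integrable lborel (\<lambda>s. G s * norm (\<psi> (- s)))"
      using past by (simp add: set_integrable_def G_def mult.assoc)
    then have "integrable lborel (\<lambda>r. G (- r) * norm (\<psi> r))"
      using lborel_integrable_real_affine_iff[of "-1" "\<lambda>s. G s * norm (\<psi> (- s))" 0] by simp
    then show "integrable lborel (\<lambda>r. indicator {..<0} r * (G (- r) * norm (\<psi> r)))"
      by (rule integrable_mult_indicator[where 'b = real, simplified, rotated]) auto
    have "set_integrable lborel {0..T} (\<lambda>r. g 0 * norm (\<psi> r))"
      by (intro borel_integrable_atLeastAtMost' continuous_intros continuous_on_subset[OF cont]) auto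
    then show "integrable lborel (\<lambda>r. indicator {0..T} r * (g 0 * norm (\<psi> r)))"
      by (simp add: set_integrable_def)
  qed
  have G_le: "\<bar>G (u - r)\<bar> * norm (\<psi> r) \<le> \<bar>W u r\<bar>" if "0 \<le> u" for u r
  proof -
    have "\<bar>G (u - r)\<bar> * norm (\<psi> r) \<le> g (- r) * norm (\<psi> r)" if "r < 0"
      using antimono[of "- r" "u - r"] nonneg[of "u - r"] that \<open>0 \<le> u\<close>
      by (auto simp: G_def intro!: mult_right_mono)
    moreover have "\<bar>G (u - r)\<bar> * norm (\<psi> r) \<le> g 0 * norm (\<psi> r)" if "0 \<le> r" "r \<le> u"
      using antimono[of 0 "u - r"] nonneg[of "u - r"] that
      by (auto simp: G_def intro!: mult_right_mono)
    moreover have "G (u - r) = 0" if "u < r" using that by (simp add: G_def)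
    moreover have "\<bar>W u r\<bar> = g (- r) * norm (\<psi> r)" if "r < 0"
      using that nonneg[of "- r"] by (simp add: W_def G_def)
    moreover have "\<bar>W u r\<bar> = g 0 * norm (\<psi> r)" if "0 \<le> r" "r \<le> u"
      using that nonneg[of 0] by (simp add: W_def)
    ultimately show ?thesis by (cases "r < 0"; cases "r \<le> u") auto
  qed
  have G_int: "integrable lborel (\<lambda>r. G (u - r) *\<^sub>R \<psi> r)" if "0 \<le> u" for u
    by (rule Bochner_Integration.integrable_bound[OF W_int[of u]]) (use G_le[OF that] in auto)
  have G'_int: "integrable lborel (\<lambda>r. G' (u - r) *\<^sub>R \<psi> r)" if "0 \<le> u" for u
  proof (rule Bochner_Integration.integrable_bound)
    show "integrable lborel (\<lambda>r. k\<^sub>1 *\<^sub>R (G (u - r) *\<^sub>R \<psi> r))"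
      by (rule integrable_scaleR_right) (rule G_int[OF that])
    have "\<bar>G' s\<bar> \<le> \<bar>k\<^sub>1 * G s\<bar>" for s
      using abs_deriv_le[of s] nonneg[of s] k\<^sub>1_pos by (simp add: G_def G'_def indicator_def)
    then show "AE r in lborel. norm (G' (u - r) *\<^sub>R \<psi> r) \<le> norm (k\<^sub>1 *\<^sub>R G (u - r) *\<^sub>R \<psi> r)"
      by (auto intro!: AE_I2 mult_right_mono)
  qed simp
  have shift: "(LINT s:{0..}|lborel. f s *\<^sub>R \<psi> (u - s)) = (\<integral>r. (indicator {0..} (u - r) * f (u - r)) *\<^sub>R \<psi> r \<partial>lborel)"
    "set_integrable lborel {0..} (\<lambda>s. f s *\<^sub>R \<psi> (u - s)) \<longleftrightarrow>
      integrable lborel (\<lambda>r. (indicator {0..} (u - r) * f (u - r)) *\<^sub>R \<psi> r)" for f u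
    using lborel_integral_real_affine[of "-1" "\<lambda>r. (indicator {0..} (u - r) * f (u - r)) *\<^sub>R \<psi> r" u]
      lborel_integrable_real_affine_iff[of "-1" "\<lambda>r. (indicator {0..} (u - r) * f (u - r)) *\<^sub>R \<psi> r" u]
    by (simp_all add: set_lebesgue_integral_def set_integrable_def)
  show "set_integrable lborel {0..} (\<lambda>s. g s *\<^sub>R \<psi> (t - s))"
    "set_integrable lborel {0..} (\<lambda>s. g' s *\<^sub>R \<psi> (t - s))"
    using G_int[OF t] G'_int[OF t] by (simp_all add: shift G_def G'_def)

  \<comment> \<open>A bounded horizon beyond \<open>t\<close> provides the single majorant
    \<open>W T\<close> for all \<open>u\<close>; the derivative at \<open>t\<close> does not see
    this cut-off.\<close>
  define T where "T = t + 1"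
  have T: "t < T" "0 \<le> T" using t by (auto simp: T_def)
  \<comment> \<open>Subtracting the jump \<open>g 0\<close> of the convolution kernel at \<open>r = u\<close> makes \<open>K\<close> Lipschitz in \<open>u\<close>.\<close>
  define K where "K u r = (if r < 0 then G (u - r) else if r \<le> T then g (max (u - r) 0) - g 0 else 0) *\<^sub>R \<psi> r" for u r
  have split: "G (u - r) *\<^sub>R \<psi> r = K u r + g 0 *\<^sub>R (indicator {0..u} r *\<^sub>R \<psi> r)" if "u \<in> {0..T}" for u r
    using that by (auto simp: K_def G_def indicator_def max_def algebra_simps)
  have ind_int: "integrable lborel (\<lambda>r. indicator {0..u} r *\<^sub>R \<psi> r)" for u
    using borel_integrable_atLeastAtMost'[OF continuous_on_subset[OF cont], of 0 u]
    by (simp add: set_integrable_def)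
  have K_int: "integrable lborel (K u)" if "u \<in> {0..T}" for u
  proof -
    have "K u = (\<lambda>r. G (u - r) *\<^sub>R \<psi> r - g 0 *\<^sub>R (indicator {0..u} r *\<^sub>R \<psi> r))"
      using split[OF that] by auto
    moreover have "integrable lborel (\<lambda>r. G (u - r) *\<^sub>R \<psi> r - g 0 *\<^sub>R (indicator {0..u} r *\<^sub>R \<psi> r))"
      by (intro Bochner_Integration.integrable_diff G_int integrable_scaleR_right ind_int) (use that in auto)
    ultimately show ?thesis by simp
  qed
  have F_eq: "(LINT s:{0..}|lborel. g s *\<^sub>R \<psi> (u - s)) = (\<integral>r. K u r \<partial>lborel) + g 0 *\<^sub>R integral {0..u} \<psi>"
    if "u \<in> {0..T}" for u
  proof -
    have "(LINT s:{0..}|lborel. g s *\<^sub>R \<psi> (u - s)) = (\<integral>r. G (u - r) *\<^sub>R \<psi> r \<partial>lborel)"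
      by (simp add: shift G_def)
    also have "\<dots> = (\<integral>r. K u r + g 0 *\<^sub>R (indicator {0..u} r *\<^sub>R \<psi> r) \<partial>lborel)"
      using split[OF that] by simp
    also have "\<dots> = (\<integral>r. K u r \<partial>lborel) + g 0 *\<^sub>R (LINT r:{0..u}|lborel. \<psi> r)"
      using Bochner_Integration.integral_add[OF K_int[OF that] integrable_scaleR_right[OF ind_int, of "g 0" u]]
      by (simp only: set_lebesgue_integral_def integral_scaleR_right)
    also have "(LINT r:{0..u}|lborel. \<psi> r) = integral {0..u} \<psi>"
      by (intro set_borel_integral_eq_integral borel_integrable_atLeastAtMost' continuous_on_subset[OF cont]) auto
    finally show ?thesis .
  qed
  have "((\<lambda>u. \<integral>r. K u r \<partial>lborel) has_vector_derivative (\<integral>r. G' (t - r) *\<^sub>R \<psi> r \<partial>lborel)) (at t within {0..T})"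
  proof (rule has_vector_derivative_integral_dominated)
    show "t \<in> {0..T}" using t T by auto
    show "integrable lborel (\<lambda>r. k\<^sub>1 * W T r)" using W_int by simp
    show "norm (K u r - K t r) \<le> \<bar>u - t\<bar> * (k\<^sub>1 * W T r)" if u: "u \<in> {0..T}" for u r
    proof -
      consider "r < 0" | "0 \<le> r" "r \<le> T" | "T < r" by linarith
      then show ?thesis
      proof cases
        case 1
        have "norm (K u r - K t r) = \<bar>g (u - r) - g (t - r)\<bar> * norm (\<psi> r)"
          using 1 u t by (simp add: K_def G_def flip: scaleR_left_diff_distrib)
        also have "\<dots> \<le> \<bar>u - t\<bar> * (k\<^sub>1 * g (- r)) * norm (\<psi> r)"
          using lipschitz_beyond[of "- r" "t - r" "u - r"] 1 u t by (intro mult_right_mono) auto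
        finally show ?thesis using 1 by (simp add: W_def G_def mult.assoc)
      next
        case 2
        have "norm (K u r - K t r) = \<bar>g (max (u - r) 0) - g (max (t - r) 0)\<bar> * norm (\<psi> r)"
          using 2 by (simp add: K_def flip: scaleR_left_diff_distrib)
        also have "\<dots> \<le> (\<bar>max (u - r) 0 - max (t - r) 0\<bar> * (k\<^sub>1 * g 0)) * norm (\<psi> r)"
          by (intro mult_right_mono lipschitz_beyond) auto
        also have "\<dots> \<le> (\<bar>u - t\<bar> * (k\<^sub>1 * g 0)) * norm (\<psi> r)"
          using k\<^sub>1_pos nonneg[of 0] by (intro mult_right_mono) auto
        finally show ?thesis using 2 by (simp add: W_def mult.assoc)
      qed (use T in \<open>simp add: K_def W_def\<close>)
    qed
    \<comment> \<open>At \<open>r = t\<close> the factor \<open>g (max (u - r) 0)\<close> may have a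
      corner in \<open>u\<close>; this single point is discarded.\<close>
    show "AE r in lborel. ((\<lambda>u. K u r) has_vector_derivative G' (t - r) *\<^sub>R \<psi> r) (at t within {0..T})"
      using AE_lborel_singleton[of t]
    proof eventually_elim
      case (elim r)
      consider "r < t" | "t < r" using elim by linarith
      then show ?case
      proof cases
        case 1
        \<comment> \<open>\<open>c\<close> merges the two formulas for \<open>K\<close>: nothing is
          subtracted for \<open>r < 0\<close>, the jump \<open>g 0\<close> for later
          \<open>r\<close>.\<close>
        define c where "c = (if r < 0 then 0 else g 0)"
        have "DERIV g (t - r) :> g' (t - r)"
          using deriv[of "t - r"] at_within_interior[of "t - r" "{0..}"] 1 by simp
        then have "DERIV (\<lambda>u. g (u - r) - c) t :> g' (t - r)"
          by (auto intro!: derivative_eq_intros DERIV_chain2[of g "g' (t - r)"])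
        then have "((\<lambda>u. (g (u - r) - c) *\<^sub>R \<psi> r) has_vector_derivative g' (t - r) *\<^sub>R \<psi> r) (at t within {0..T})"
          by (intro bounded_linear.has_vector_derivative[OF bounded_linear_scaleR_left])
            (simp add: has_real_derivative_iff_has_vector_derivative has_vector_derivative_at_within)
        then have "((\<lambda>u. K u r) has_vector_derivative g' (t - r) *\<^sub>R \<psi> r) (at t within {0..T})"
        proof (rule has_vector_derivative_transform_within[of _ _ _ _ "t - r"])
          show "(g (u - r) - c) *\<^sub>R \<psi> r = K u r" if "u \<in> {0..T}" "dist u t < t - r" for u
            using that 1 T by (auto simp: K_def G_def c_def dist_real_def)
        qed (use 1 t T in auto)
        then show ?thesis using 1 by (simp add: G'_def)
      next
        case 2
        have "((\<lambda>u. 0) has_vector_derivative 0) (at t within {0..T})" by simp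
        then have "((\<lambda>u. K u r) has_vector_derivative 0) (at t within {0..T})"
        proof (rule has_vector_derivative_transform_within[of _ _ _ _ "r - t"])
          show "0 = K u r" if "u \<in> {0..T}" "dist u t < r - t" for u
            using that 2 t by (auto simp: K_def dist_real_def)
        qed (use 2 t T in auto)
        then show ?thesis using 2 by (simp add: G'_def)
      qed
    qed
  qed (use K_int in auto)
  moreover have "((\<lambda>u. integral {0..u} \<psi>) has_vector_derivative \<psi> t) (at t within {0..T})"
    using t T by (intro integral_has_vector_derivative continuous_on_subset[OF cont]) auto
  ultimately have "((\<lambda>u. (\<integral>r. K u r \<partial>lborel) + g 0 *\<^sub>R integral {0..u} \<psi>) has_vector_derivative
      (\<integral>r. G' (t - r) *\<^sub>R \<psi> r \<partial>lborel) + g 0 *\<^sub>R \<psi> t) (at t within {0..T})"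
    by (intro has_vector_derivative_add bounded_linear.has_vector_derivative[OF bounded_linear_scaleR_right])
  then have "((\<lambda>u. LINT s:{0..}|lborel. g s *\<^sub>R \<psi> (u - s)) has_vector_derivative
      (\<integral>r. G' (t - r) *\<^sub>R \<psi> r \<partial>lborel) + g 0 *\<^sub>R \<psi> t) (at t within {0..T})"
    by (rule has_vector_derivative_transform_within[of _ _ _ _ 1]) (use t T F_eq in auto)
  moreover have "at t within {0..T} = at t within {0..}"
    by (rule at_within_nhd[of _ "{..<T}"]) (use T in auto)
  ultimately show "((\<lambda>u. LINT s:{0..}|lborel. g s *\<^sub>R \<psi> (u - s)) has_vector_derivative
        g 0 *\<^sub>R \<psi> t + (LINT s:{0..}|lborel. g' s *\<^sub>R \<psi> (t - s))) (at t within {0..})"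
    by (simp add: shift G'_def add.commute)
qed

lemma integral_deriv: \<comment> \<open>the convolution with the constant \<open>1\<close> is constant\<close>
  shows "set_integrable lborel {0..} g'" "(LINT s:{0..}|lborel. g' s) = - g 0"
proof -
  have p: "set_integrable lborel {0..} (\<lambda>s. g s * norm (1::real))" using set_integrable by simp
  note c = memory_integral[OF continuous_on_const p zero_le_one, simplified]
  show "set_integrable lborel {0..} g'" by (rule c(2))
  have "((\<lambda>_. LINT s:{0..}|lborel. g s) has_vector_derivative g 0 + (LINT s:{0..}|lborel. g' s)) (at 1)"
    using c(3) at_within_interior[of 1 "{0::real..}"] by simp
  from vector_derivative_unique_at[OF this has_vector_derivative_const]
  show "(LINT s:{0..}|lborel. g' s) = - g 0" by simp
qed

text \<open>Formally \<open>\<mu>' = \<integral> g (y - \<eta>\<^sub>s)\<close>, and integration by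
  parts with \<open>\<eta> t 0 = 0\<close> turns the second part into
  \<open>R = \<integral> g' \<eta>\<close>; likewise \<open>N'\<close> contains
  \<open>\<integral> g' |\<eta>|^2\<close>. The proof reaches these formulas by writing
  \<open>\<mu>\<close> and \<open>N\<close> through \<open>Y\<close>, \<open>F\<close> and
  \<open>P\<close>, differentiating the convolutions, and reassembling the result with
  \<open>\<integral> g' = - g 0\<close>.\<close>

lemma history_functionals:
  fixes \<eta> :: "real \<Rightarrow> real \<Rightarrow> complex" and y :: "real \<Rightarrow> complex"
  assumes cont: "continuous_on ({0..} \<times> {0..}) (\<lambda>(t, s). \<eta> t s)"
    and transport: "\<And>t s. 0 \<le> t \<Longrightarrow> 0 \<le> s \<Longrightarrow> s \<noteq> t \<Longrightarrow> \<exists>\<eta>\<^sub>t \<eta>\<^sub>s.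
      ((\<lambda>(t, s). \<eta> t s) has_derivative (\<lambda>(dt, ds). dt *\<^sub>R \<eta>\<^sub>t + ds *\<^sub>R \<eta>\<^sub>s)) (at (t, s) within {0..} \<times> {0..}) \<and>
      \<eta>\<^sub>t + \<eta>\<^sub>s - y t = 0"
    and bd: "\<And>t. 0 \<le> t \<Longrightarrow> \<eta> t 0 = 0"
    and int0: "set_integrable lborel {0..} (\<lambda>s. g s * (cmod (\<eta> 0 s))\<^sup>2)"
    and cont_y: "continuous_on {0..} y"
    and t: "0 \<le> t"
    and b\<^sub>0_def: "b\<^sub>0 = (LINT s:{0..}|lborel. g s)"
    and \<mu>_def: "\<mu> = (\<lambda>t. LINT s:{0..}|lborel. of_real (g s) * \<eta> t s)"
    and N_def: "N = (\<lambda>t. LINT s:{0..}|lborel. g s * (cmod (\<eta> t s))\<^sup>2)"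
  shows "\<exists>R. (\<mu> has_vector_derivative b\<^sub>0 * y t + R) (at t within {0..}) \<and> (cmod R)\<^sup>2 \<le> k\<^sub>1\<^sup>2 * (b\<^sub>0 * N t)"
    and "\<exists>N'. (N has_real_derivative N') (at t within {0..}) \<and> N' \<le> 2 * Re (cnj (y t) * \<mu> t) - k\<^sub>2 * N t"
    and "(cmod (\<mu> t))\<^sup>2 \<le> b\<^sub>0 * N t"
    and "0 \<le> N t"
proof -
  define Y where "Y t = integral {0..t} y" for t
  have Y: "(Y has_vector_derivative y t) (at t within {0..})" if "0 \<le> t" for t
  proof -
    have "(Y has_vector_derivative y t) (at t within {0..t+1})"
      unfolding Y_def[abs_def]
      using that by (intro integral_has_vector_derivative continuous_on_subset[OF cont_y]) auto
    moreover have "at t within {0..t+1} = at t within {0..}"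
      by (rule at_within_nhd[of _ "{..<t+1}"]) auto
    ultimately show ?thesis by simp
  qed
  define \<psi> where "\<psi> = (\<lambda>r. if 0 \<le> r then Y r else - \<eta> 0 (- r))"
  have Y0: "Y 0 = 0" by (simp add: Y_def)
  note char = transport_characteristics[OF cont transport bd Y Y0 \<psi>_def]
  have cont_\<psi>: "continuous_on UNIV \<psi>" by (rule char(1))
  have \<eta>_eq: "\<eta> t s = Y t - \<psi> (t - s)" if "0 \<le> t" "0 \<le> s" for t s
    by (rule char(2)) (use that in auto)
  have \<psi>_past: "\<psi> (- s) = - \<eta> 0 s" if "0 \<le> s" for s
    using \<eta>_eq[of 0 s] that Y0 by simp
  have \<psi>_t: "\<psi> t = Y t" using t by (simp add: \<psi>_def)
  have [measurable]: "\<psi> \<in> borel_measurable borel"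
    using cont_\<psi> by (rule borel_measurable_continuous_onI)
  note [measurable] = measurable_on_nonneg
  have past2: "set_integrable lborel {0..} (\<lambda>s. g s * norm ((cmod (\<psi> (- s)))\<^sup>2))"
    using int0 unfolding set_integrable_def
    by (rule Bochner_Integration.integrable_cong[THEN iffD1, OF refl, rotated])
      (auto simp: indicator_def \<psi>_past)
  have past1: "set_integrable lborel {0..} (\<lambda>s. g s * norm (\<psi> (- s)))"
  proof (rule set_integrable_bound)
    show "set_integrable lborel {0..} (\<lambda>s. g s + g s * norm ((cmod (\<psi> (- s)))\<^sup>2))"
      by (intro set_integral_add set_integrable past2)
    show "set_borel_measurable lborel {0..} (\<lambda>s. g s * norm (\<psi> (- s)))"
      unfolding set_borel_measurable_def by (simp flip: mult.assoc)
    have "x \<le> 1 + x\<^sup>2" for x :: real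
      using zero_le_power2[of "x - 1 / 2"] by (simp add: power2_eq_square algebra_simps)
    from mult_left_mono[OF this nonneg]
    have "g s * x \<le> g s + g s * x\<^sup>2" if "0 \<le> s" for s x :: real using that by (simp add: algebra_simps)
    then show "AE s in lborel. s \<in> {0..} \<longrightarrow> norm (g s * norm (\<psi> (- s))) \<le> norm (g s + g s * norm ((cmod (\<psi> (- s)))\<^sup>2))"
      using nonneg by auto
  qed
  have cont2: "continuous_on UNIV (\<lambda>r. (cmod (\<psi> r))\<^sup>2)"
    by (intro continuous_intros cont_\<psi>)

  define h h' where "h s = indicator {0..} s * g s" and "h' s = indicator {0..} s * g' s" for s :: real
  define F where "F u = (\<integral>s. h s *\<^sub>R \<psi> (u - s) \<partial>lborel)" for u
  define P where "P u = (\<integral>s. h s * (cmod (\<psi> (u - s)))\<^sup>2 \<partial>lborel)" for u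
  define F' where "F' = (\<integral>s. h' s *\<^sub>R \<psi> (t - s) \<partial>lborel)"
  define P' where "P' = (\<integral>s. h' s * (cmod (\<psi> (t - s)))\<^sup>2 \<partial>lborel)"
  have h: "integrable lborel h" "(\<integral>s. h s \<partial>lborel) = b\<^sub>0" "\<And>s. 0 \<le> h s"
    using set_integrable nonneg
    by (auto simp: h_def[abs_def] b\<^sub>0_def set_integrable_def set_lebesgue_integral_def indicator_def)
  have h': "integrable lborel h'" "(\<integral>s. h' s \<partial>lborel) = - g 0"
    using integral_deriv by (auto simp: h'_def[abs_def] set_integrable_def set_lebesgue_integral_def)
  have h_F: "integrable lborel (\<lambda>s. h s *\<^sub>R \<psi> (u - s))" if "0 \<le> u" for u
    using memory_integrable[OF cont_\<psi> past1 that] by (simp add: h_def set_integrable_def)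
  have h_P: "integrable lborel (\<lambda>s. h s * (cmod (\<psi> (u - s)))\<^sup>2)" if "0 \<le> u" for u
    using memory_integrable[OF cont2 past2 that] by (simp add: h_def set_integrable_def mult.assoc)
  have h'_F: "integrable lborel (\<lambda>s. h' s *\<^sub>R \<psi> (t - s))"
    using memory_deriv_integrable[OF cont_\<psi> past1 t] by (simp add: h'_def set_integrable_def)
  have h'_P: "integrable lborel (\<lambda>s. h' s * (cmod (\<psi> (t - s)))\<^sup>2)"
    using memory_deriv_integrable[OF cont2 past2 t] by (simp add: h'_def set_integrable_def mult.assoc)
  have dF: "(F has_vector_derivative g 0 *\<^sub>R Y t + F') (at t within {0..})"
    using memory_has_vector_derivative[OF cont_\<psi> past1 t] \<psi>_t
    by (simp add: F_def[abs_def] F'_def h_def h'_def set_lebesgue_integral_def)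
  have dP: "(P has_vector_derivative g 0 * (cmod (Y t))\<^sup>2 + P') (at t within {0..})"
    using memory_has_vector_derivative[OF cont2 past2 t] \<psi>_t
    by (simp add: P_def[abs_def] P'_def h_def h'_def set_lebesgue_integral_def mult.assoc)
  have h_\<eta>: "h s *\<^sub>R \<eta> u s = h s *\<^sub>R Y u - h s *\<^sub>R \<psi> (u - s)"
    "h s * (cmod (\<eta> u s))\<^sup>2 = h s * (cmod (Y u - \<psi> (u - s)))\<^sup>2"
    "h' s *\<^sub>R \<eta> u s = h' s *\<^sub>R Y u - h' s *\<^sub>R \<psi> (u - s)"
    "h' s * (cmod (\<eta> u s))\<^sup>2 = h' s * (cmod (Y u - \<psi> (u - s)))\<^sup>2" if "0 \<le> u" for u s
    using \<eta>_eq[OF that, of s] by (auto simp: h_def h'_def indicator_def scaleR_diff_right)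
  have \<mu>_alt: "\<mu> u = (\<integral>s. h s *\<^sub>R \<eta> u s \<partial>lborel)" for u
    by (simp add: \<mu>_def h_def set_lebesgue_integral_def scaleR_conv_of_real mult.assoc)
  have \<mu>: "\<mu> u = b\<^sub>0 *\<^sub>R Y u - F u" if "0 \<le> u" for u
    unfolding \<mu>_alt h_\<eta>[OF that] using h h_F[OF that] by (simp add: F_def)
  have N_alt: "N u = (\<integral>s. h s * (cmod (\<eta> u s))\<^sup>2 \<partial>lborel)" for u
    by (simp add: N_def h_def set_lebesgue_integral_def mult.assoc)
  have N: "N u = (cmod (Y u))\<^sup>2 * b\<^sub>0 - 2 * Re (F u * cnj (Y u)) + P u"
    and N_int: "integrable lborel (\<lambda>s. h s * (cmod (\<eta> u s))\<^sup>2)" if "0 \<le> u" for u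
    using weighted_square_integral[OF h(1) h_F[OF that] h_P[OF that], of "Y u"]
    by (simp_all only: N_alt h_\<eta>[OF that] F_def P_def h(2) mult.commute[of "cnj _"])
  have h_\<eta>_int: "integrable lborel (\<lambda>s. h s *\<^sub>R \<eta> u s)" if "0 \<le> u" for u
    unfolding h_\<eta>[OF that] using h h_F[OF that] by simp
  have b\<^sub>0_pos: "0 < b\<^sub>0" unfolding b\<^sub>0_def by (rule integral_pos)
  show "0 \<le> N t"
    unfolding N_alt by (rule Bochner_Integration.integral_nonneg) (use h in auto)
  show "(cmod (\<mu> t))\<^sup>2 \<le> b\<^sub>0 * N t"
    unfolding \<mu>_alt N_alt h(2)[symmetric]
    by (rule weighted_Cauchy_Schwarz) (use h h_\<eta>_int t N_int b\<^sub>0_pos in auto)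

  show "\<exists>R. (\<mu> has_vector_derivative b\<^sub>0 * y t + R) (at t within {0..}) \<and> (cmod R)\<^sup>2 \<le> k\<^sub>1\<^sup>2 * (b\<^sub>0 * N t)"
  proof (intro exI conjI)
    define R where "R = (\<integral>s. h' s *\<^sub>R \<eta> t s \<partial>lborel)"
    have R: "R = - (g 0 *\<^sub>R Y t + F')"
      unfolding R_def h_\<eta>[OF t] using h' h'_F by (simp add: F'_def)
    have "((\<lambda>u. b\<^sub>0 *\<^sub>R Y u - F u) has_vector_derivative b\<^sub>0 *\<^sub>R y t - (g 0 *\<^sub>R Y t + F')) (at t within {0..})"
      by (intro has_vector_derivative_diff bounded_linear.has_vector_derivative[OF bounded_linear_scaleR_right] Y t dF)
    then have "(\<mu> has_vector_derivative b\<^sub>0 *\<^sub>R y t - (g 0 *\<^sub>R Y t + F')) (at t within {0..})"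
      by (rule has_vector_derivative_transform_within[of _ _ _ _ 1]) (use t \<mu> in auto)
    then show "(\<mu> has_vector_derivative b\<^sub>0 * y t + R) (at t within {0..})"
      by (simp add: R scaleR_conv_of_real algebra_simps)
    \<comment> \<open>The weight \<open>h'\<close> is nonpositive, so
      \<open>\<bar>h'\<bar> \<le> k\<^sub>1 * h\<close> is used first. The integral of
      \<open>h * cmod \<eta>\<close> is then read as the complex number \<open>Q\<close>, to which
      the weighted Cauchy-Schwarz inequality applies.\<close>
    define Q where "Q = (\<integral>s. h s *\<^sub>R of_real (cmod (\<eta> t s)) \<partial>lborel :: complex)"
    have abs_int: "integrable lborel (\<lambda>s. h s *\<^sub>R (of_real (cmod (\<eta> t s)) :: complex))"
    proof -
      have "integrable lborel (\<lambda>s. h s * cmod (\<eta> t s))"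
        using integrable_norm[OF h_\<eta>_int[OF t]] h(3) by simp
      from integrable_of_real[OF this] show ?thesis
        by (simp add: scaleR_conv_of_real)
    qed
    have "cmod R \<le> (\<integral>s. k\<^sub>1 * (h s * cmod (\<eta> t s)) \<partial>lborel)"
      unfolding R_def
    proof (rule order_trans[OF integral_norm_bound], rule integral_mono)
      have "integrable lborel (\<lambda>s. h' s *\<^sub>R \<eta> t s)"
        unfolding h_\<eta>[OF t] using h' h'_F by simp
      then show "integrable lborel (\<lambda>s. norm (h' s *\<^sub>R \<eta> t s))"
        by (rule integrable_norm)
      show "integrable lborel (\<lambda>s. k\<^sub>1 * (h s * cmod (\<eta> t s)))"
        using integrable_norm[OF h_\<eta>_int[OF t]] h(3) by simp
      have "\<bar>h' s\<bar> \<le> k\<^sub>1 * h s" for s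
        using abs_deriv_le[of s] by (simp add: h_def h'_def indicator_def)
      then show "norm (h' s *\<^sub>R \<eta> t s) \<le> k\<^sub>1 * (h s * cmod (\<eta> t s))" for s
        by (simp add: mult_right_mono flip: mult.assoc)
    qed
    also have "\<dots> = k\<^sub>1 * cmod Q"
    proof -
      have "Q = of_real (\<integral>s. h s * cmod (\<eta> t s) \<partial>lborel)"
        unfolding Q_def by (simp add: scaleR_conv_of_real flip: of_real_mult)
      moreover have "0 \<le> (\<integral>s. h s * cmod (\<eta> t s) \<partial>lborel)"
        by (rule Bochner_Integration.integral_nonneg) (use h in auto)
      ultimately show ?thesis by simp
    qed
    finally have "(cmod R)\<^sup>2 \<le> (k\<^sub>1 * cmod Q)\<^sup>2" by (rule power_mono) simp
    also have "\<dots> = k\<^sub>1\<^sup>2 * (cmod Q)\<^sup>2" by (simp add: power_mult_distrib)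
    also have "(cmod Q)\<^sup>2 \<le> b\<^sub>0 * N t"
      unfolding Q_def N_alt h(2)[symmetric]
      using weighted_Cauchy_Schwarz[OF h(1) abs_int] h b\<^sub>0_pos N_int[OF t] by simp
    finally show "(cmod R)\<^sup>2 \<le> k\<^sub>1\<^sup>2 * (b\<^sub>0 * N t)" by (simp add: mult_left_mono)
  qed

  show "\<exists>N'. (N has_real_derivative N') (at t within {0..}) \<and> N' \<le> 2 * Re (cnj (y t) * \<mu> t) - k\<^sub>2 * N t"
  proof (intro exI conjI)
    define N' where "N' = 2 * Re (y t * cnj (Y t)) * b\<^sub>0
      - 2 * Re ((g 0 *\<^sub>R Y t + F') * cnj (Y t) + F t * cnj (y t)) + (g 0 * (cmod (Y t))\<^sup>2 + P')"
    have "((\<lambda>u. (cmod (Y u))\<^sup>2 * b\<^sub>0 - 2 * Re (F u * cnj (Y u)) + P u) has_real_derivative N') (at t within {0..})"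
      unfolding N'_def
      by (intro DERIV_add DERIV_diff DERIV_cmult DERIV_cmult_right has_real_derivative_cmod_power2
          has_real_derivative_Re_mult_cnj dP[folded has_real_derivative_iff_has_vector_derivative] dF Y t)
    then show "(N has_real_derivative N') (at t within {0..})"
      by (rule has_field_derivative_transform_within[of _ _ _ _ 1]) (use t N in auto)
    have h'_N: "(\<integral>s. h' s * (cmod (\<eta> t s))\<^sup>2 \<partial>lborel)
        = - (cmod (Y t))\<^sup>2 * g 0 - 2 * Re (cnj (Y t) * F') + P'"
      and h'_N_int: "integrable lborel (\<lambda>s. h' s * (cmod (\<eta> t s))\<^sup>2)"
      using weighted_square_integral[OF h'(1) h'_F h'_P, of "Y t"]
      by (simp_all add: h_\<eta>[OF t] F'_def P'_def h'(2))
    \<comment> \<open>The multiples of \<open>g 0 * (cmod (Y t))\<^sup>2\<close> in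
      \<open>N'\<close> add up to \<open>-1\<close>, which is the contribution of
      \<open>\<integral> g' = - g 0\<close>; the terms with \<open>y\<close> combine through
      \<open>\<mu> = b\<^sub>0 Y - F\<close>.\<close>
    have "N' = 2 * Re (cnj (y t) * \<mu> t) + (\<integral>s. h' s * (cmod (\<eta> t s))\<^sup>2 \<partial>lborel)"
      unfolding N'_def h'_N \<mu>[OF t] unfolding cmod_power2 by (simp add: power2_eq_square algebra_simps)
    also have "(\<integral>s. h' s * (cmod (\<eta> t s))\<^sup>2 \<partial>lborel) \<le> (\<integral>s. - k\<^sub>2 * (h s * (cmod (\<eta> t s))\<^sup>2) \<partial>lborel)"
    proof (rule integral_mono)
      have "h' s \<le> - k\<^sub>2 * h s" for s
        using deriv_le[of s] by (simp add: h_def h'_def indicator_def)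
      from mult_right_mono[OF this zero_le_power2]
      show "h' s * (cmod (\<eta> t s))\<^sup>2 \<le> - k\<^sub>2 * (h s * (cmod (\<eta> t s))\<^sup>2)" for s by (simp add: mult.assoc)
    qed (use h'_N_int N_int[OF t] in auto)
    also have "\<dots> = - k\<^sub>2 * N t" unfolding N_alt by simp
    finally show "N' \<le> 2 * Re (cnj (y t) * \<mu> t) - k\<^sub>2 * N t" by simp
  qed
qed

end

section \<open>Multipliers at a fixed frequency\<close>

lemma abs_Re_mult_cnj_le: "\<bar>Re (a * cnj b)\<bar> \<le> cmod a * cmod b"
  using abs_Re_le_cmod[of "a * cnj b"] by (simp add: norm_mult)

lemma abs_Im_mult_cnj_le: "\<bar>Im (a * cnj b)\<bar> \<le> cmod a * cmod b"
  using abs_Im_le_cmod[of "a * cnj b"] by (simp add: norm_mult)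

text \<open>\<open>c\<close> is what is left of the frequency weight once \<open>B\<close> has taken
  its share. In the applications it is a monomial in \<open>p\<close> and \<open>\<sigma>\<close>,
  hence at most 1, and is dropped; \<open>c = 1\<close> marks a coupling that uses up its weights
  exactly.\<close>

lemma weighted_term_le:
  fixes w r n c B :: real
  assumes "\<bar>r\<bar> \<le> n" "\<bar>w\<bar> * n = c * B" "0 \<le> B" "c \<le> 1"
  shows "\<bar>w * r\<bar> \<le> B"
proof -
  have "\<bar>w * r\<bar> \<le> \<bar>w\<bar> * n" using assms(1) by (simp add: abs_mult mult_left_mono)
  also have "\<dots> \<le> B" using assms(2,3,4) mult_right_mono[of c 1 B] by simp
  finally show ?thesis .
qed

lemma weighted_square_le: "0 \<le> C \<Longrightarrow> c \<le> 1 \<Longrightarrow> C * (c * B\<^sup>2) \<le> C * (B::real)\<^sup>2"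
  using mult_right_mono[of c 1 "B\<^sup>2"] by (simp add: mult_left_mono)

text \<open>One instant is frozen: primed letters are complex numbers standing for time derivatives,
  so each multiplier identity becomes pure algebra.\<close>

context
  fixes \<rho>\<^sub>1 \<rho>\<^sub>2 \<rho>\<^sub>3 k a m \<delta> \<beta> \<tau> b\<^sub>0 \<xi> \<sigma> p :: real
    and v u z y \<theta> q \<mu> R v' u' z' y' \<theta>' q' \<mu>' :: complex
  assumes pos: "\<rho>\<^sub>1 > 0" "\<rho>\<^sub>2 > 0" "\<rho>\<^sub>3 > 0" "k > 0" "a > 0" "m > 0" "\<delta> > 0" "\<beta> > 0" "\<tau> > 0"
    and \<sigma>: "0 < \<sigma>" and p: "p = \<bar>\<xi>\<bar> * \<sigma>" and circle: "p\<^sup>2 + \<sigma>\<^sup>2 = 1"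
    and v': "v' = \<i> * of_real \<xi> * u - y"
    and u': "of_real \<rho>\<^sub>1 * u' = \<i> * of_real k * of_real \<xi> * v"
    and z': "z' = \<i> * of_real \<xi> * y"
    and y': "of_real \<rho>\<^sub>2 * y' = \<i> * of_real a * of_real \<xi> * z - of_real m * (of_real \<xi>)\<^sup>2 * \<mu>
      + of_real k * v - \<i> * of_real \<delta> * of_real \<xi> * \<theta>"
    and \<theta>': "of_real \<rho>\<^sub>3 * \<theta>' = - \<i> * of_real \<xi> * q - \<i> * of_real \<delta> * of_real \<xi> * y"
    and q': "of_real \<tau> * q' = - of_real \<beta> * q - \<i> * of_real \<xi> * \<theta>"
    and \<mu>': "\<mu>' = of_real b\<^sub>0 * y + R"
begin

lemma p_\<sigma>_bounds: "0 \<le> p" "p \<le> 1" "\<sigma> \<le> 1" "p\<^sup>2 \<le> 1" "\<sigma>\<^sup>2 \<le> 1"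
proof -
  show "0 \<le> p" using p \<sigma> by simp
  show "p\<^sup>2 \<le> 1" "\<sigma>\<^sup>2 \<le> 1" using circle by (smt (verit) zero_le_power2)+
  then show "p \<le> 1" "\<sigma> \<le> 1" by (auto intro: power2_le_imp_le[of _ 1, simplified])
qed

text \<open>The coefficients stay on the left so that products such as
  \<open>\<rho>\<^sub>2 * Re y'\<close> can be substituted into the multiplier identities without
  division.\<close>

lemma Re_Im_equations:
  "\<rho>\<^sub>1 * Re u' = - k * \<xi> * Im v" "\<rho>\<^sub>1 * Im u' = k * \<xi> * Re v"
  "\<rho>\<^sub>2 * Re y' = - a * \<xi> * Im z - m * \<xi>\<^sup>2 * Re \<mu> + k * Re v + \<delta> * \<xi> * Im \<theta>"
  "\<rho>\<^sub>2 * Im y' = a * \<xi> * Re z - m * \<xi>\<^sup>2 * Im \<mu> + k * Im v - \<delta> * \<xi> * Re \<theta>"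
  "\<rho>\<^sub>3 * Re \<theta>' = \<xi> * Im q + \<delta> * \<xi> * Im y" "\<rho>\<^sub>3 * Im \<theta>' = - \<xi> * Re q - \<delta> * \<xi> * Re y"
  "\<tau> * Re q' = - \<beta> * Re q + \<xi> * Im \<theta>" "\<tau> * Im q' = - \<beta> * Im q - \<xi> * Re \<theta>"
  using arg_cong[OF u', of Re] arg_cong[OF u', of Im] arg_cong[OF y', of Re] arg_cong[OF y', of Im]
    arg_cong[OF \<theta>', of Re] arg_cong[OF \<theta>', of Im] arg_cong[OF q', of Re] arg_cong[OF q', of Im]
  by (simp_all flip: of_real_power)

text \<open>Cattaneo's law puts \<open>- \<i> \<xi> \<theta>\<close> into \<open>\<tau> q'\<close>,
  so pairing \<open>q\<close> with \<open>\<theta>\<close> yields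
  \<open>- \<rho>\<^sub>3 \<xi> |\<theta>|^2\<close>. The prefactor \<open>\<sigma>^2 \<xi>\<close>
  makes this \<open>p^2\<close>, and the price, a multiple of \<open>|q|^2\<close>, is already
  dissipated.\<close>

lemma \<theta>_dissipation:
  "\<sigma>\<^sup>2 * (\<tau> * \<rho>\<^sub>3 * \<xi> * Im (q' * cnj \<theta> + q * cnj \<theta>'))
    \<le> - \<rho>\<^sub>3 * (p * cmod \<theta>)\<^sup>2 + \<rho>\<^sub>3 * \<beta> * (cmod q * (p * cmod \<theta>))
      + \<tau> * (cmod q)\<^sup>2 + \<tau> * \<delta> * (cmod q * (p * cmod y))"
proof -
  have "\<tau> * \<rho>\<^sub>3 * Im (q' * cnj \<theta> + q * cnj \<theta>')
      = \<rho>\<^sub>3 * ((\<tau> * Im q') * Re \<theta> - (\<tau> * Re q') * Im \<theta>) + \<tau> * (Im q * (\<rho>\<^sub>3 * Re \<theta>') - Re q * (\<rho>\<^sub>3 * Im \<theta>'))"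
    by (simp add: algebra_simps)
  also have "\<dots> = - \<rho>\<^sub>3 * \<xi> * (cmod \<theta>)\<^sup>2 - \<rho>\<^sub>3 * \<beta> * Im (q * cnj \<theta>) + \<tau> * \<xi> * (cmod q)\<^sup>2
      + \<tau> * \<delta> * \<xi> * Re (q * cnj y)"
    unfolding Re_Im_equations cmod_power2 by (simp add: algebra_simps power2_eq_square)
  finally have "\<sigma>\<^sup>2 * (\<tau> * \<rho>\<^sub>3 * \<xi> * Im (q' * cnj \<theta> + q * cnj \<theta>'))
      = \<sigma>\<^sup>2 * \<xi> * (- \<rho>\<^sub>3 * \<xi> * (cmod \<theta>)\<^sup>2 - \<rho>\<^sub>3 * \<beta> * Im (q * cnj \<theta>) + \<tau> * \<xi> * (cmod q)\<^sup>2
      + \<tau> * \<delta> * \<xi> * Re (q * cnj y))" by simp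
  also have "\<dots> = - \<rho>\<^sub>3 * (p * cmod \<theta>)\<^sup>2 + (- \<sigma>\<^sup>2 * \<rho>\<^sub>3 * \<beta> * \<xi>) * Im (q * cnj \<theta>)
      + \<tau> * (p\<^sup>2 * (cmod q)\<^sup>2) + (\<sigma>\<^sup>2 * \<tau> * \<delta> * \<xi>\<^sup>2) * Re (q * cnj y)"
    unfolding p power_mult_distrib power2_abs by (simp add: algebra_simps power2_eq_square)
  finally have eq: "\<sigma>\<^sup>2 * (\<tau> * \<rho>\<^sub>3 * \<xi> * Im (q' * cnj \<theta> + q * cnj \<theta>')) = \<dots>" .
  have "\<bar>(- \<sigma>\<^sup>2 * \<rho>\<^sub>3 * \<beta> * \<xi>) * Im (q * cnj \<theta>)\<bar> \<le> \<rho>\<^sub>3 * \<beta> * (cmod q * (p * cmod \<theta>))"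
    by (rule weighted_term_le[OF abs_Im_mult_cnj_le, where c = \<sigma>])
      (use pos \<sigma> p_\<sigma>_bounds in \<open>auto simp: abs_mult p power2_eq_square\<close>)
  moreover have "\<bar>(\<sigma>\<^sup>2 * \<tau> * \<delta> * \<xi>\<^sup>2) * Re (q * cnj y)\<bar> \<le> \<tau> * \<delta> * (cmod q * (p * cmod y))"
    by (rule weighted_term_le[OF abs_Re_mult_cnj_le, where c = p])
      (use pos \<sigma> p_\<sigma>_bounds in \<open>auto simp: abs_mult p power2_eq_square\<close>)
  moreover have "\<tau> * (p\<^sup>2 * (cmod q)\<^sup>2) \<le> \<tau> * (cmod q)\<^sup>2"
    by (rule weighted_square_le) (use pos p_\<sigma>_bounds in auto)
  ultimately show ?thesis unfolding eq by linarith
qed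

text \<open>The memory acts as an observer of \<open>y\<close>, because \<open>\<mu>'\<close>
  contains \<open>b\<^sub>0 y\<close>. Every error has a factor \<open>|\<xi>| |\<mu>|\<close> or
  \<open>|\<xi>| |R|\<close>, both controlled by the dissipated \<open>\<xi>^2 N\<close>, so the
  cost is paid by a large multiple of the energy.\<close>

lemma y_dissipation:
  "p\<^sup>2 * (- \<rho>\<^sub>2 * Re (y' * cnj \<mu> + y * cnj \<mu>'))
    \<le> - \<rho>\<^sub>2 * b\<^sub>0 * (p * cmod y)\<^sup>2 + \<rho>\<^sub>2 * ((p * cmod y) * (\<bar>\<xi>\<bar> * cmod R))
      + a * ((p\<^sup>2 * cmod z) * (\<bar>\<xi>\<bar> * cmod \<mu>)) + m * (\<bar>\<xi>\<bar> * cmod \<mu>)\<^sup>2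
      + k * ((p * \<sigma> * cmod v) * (\<bar>\<xi>\<bar> * cmod \<mu>)) + \<delta> * ((p * cmod \<theta>) * (\<bar>\<xi>\<bar> * cmod \<mu>))"
proof -
  have "- \<rho>\<^sub>2 * Re (y' * cnj \<mu> + y * cnj \<mu>')
      = - ((\<rho>\<^sub>2 * Re y') * Re \<mu> + (\<rho>\<^sub>2 * Im y') * Im \<mu>) - \<rho>\<^sub>2 * (Re y * Re \<mu>' + Im y * Im \<mu>')"
    by (simp add: algebra_simps)
  also have "\<dots> = - \<rho>\<^sub>2 * b\<^sub>0 * (cmod y)\<^sup>2 - \<rho>\<^sub>2 * Re (y * cnj R) + a * \<xi> * Im (z * cnj \<mu>)
      + m * \<xi>\<^sup>2 * (cmod \<mu>)\<^sup>2 - k * Re (v * cnj \<mu>) - \<delta> * \<xi> * Im (\<theta> * cnj \<mu>)"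
    unfolding Re_Im_equations \<mu>' cmod_power2 by (simp add: algebra_simps power2_eq_square)
  finally have "p\<^sup>2 * (- \<rho>\<^sub>2 * Re (y' * cnj \<mu> + y * cnj \<mu>')) = p\<^sup>2 * \<dots>" by simp
  also have "\<dots> = - \<rho>\<^sub>2 * b\<^sub>0 * (p * cmod y)\<^sup>2 + (- p\<^sup>2 * \<rho>\<^sub>2) * Re (y * cnj R)
      + (p\<^sup>2 * a * \<xi>) * Im (z * cnj \<mu>) + m * (p\<^sup>2 * (\<bar>\<xi>\<bar> * cmod \<mu>)\<^sup>2)
      + (- p\<^sup>2 * k) * Re (v * cnj \<mu>) + (- p\<^sup>2 * \<delta> * \<xi>) * Im (\<theta> * cnj \<mu>)"
    unfolding power_mult_distrib power2_abs by (simp only: algebra_simps)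
  finally have eq: "p\<^sup>2 * (- \<rho>\<^sub>2 * Re (y' * cnj \<mu> + y * cnj \<mu>')) = \<dots>" .
  have "\<bar>(- p\<^sup>2 * \<rho>\<^sub>2) * Re (y * cnj R)\<bar> \<le> \<rho>\<^sub>2 * ((p * cmod y) * (\<bar>\<xi>\<bar> * cmod R))"
    by (rule weighted_term_le[OF abs_Re_mult_cnj_le, where c = \<sigma>])
      (use pos \<sigma> p_\<sigma>_bounds in \<open>auto simp: abs_mult p power2_eq_square\<close>)
  moreover have "\<bar>(p\<^sup>2 * a * \<xi>) * Im (z * cnj \<mu>)\<bar> \<le> a * ((p\<^sup>2 * cmod z) * (\<bar>\<xi>\<bar> * cmod \<mu>))"
    by (rule weighted_term_le[OF abs_Im_mult_cnj_le, where c = 1])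
      (use pos \<sigma> p_\<sigma>_bounds in \<open>auto simp: abs_mult p power2_eq_square\<close>)
  moreover have "\<bar>(- p\<^sup>2 * k) * Re (v * cnj \<mu>)\<bar> \<le> k * ((p * \<sigma> * cmod v) * (\<bar>\<xi>\<bar> * cmod \<mu>))"
    by (rule weighted_term_le[OF abs_Re_mult_cnj_le, where c = 1])
      (use pos \<sigma> p_\<sigma>_bounds in \<open>auto simp: abs_mult p power2_eq_square\<close>)
  moreover have "\<bar>(- p\<^sup>2 * \<delta> * \<xi>) * Im (\<theta> * cnj \<mu>)\<bar> \<le> \<delta> * ((p * cmod \<theta>) * (\<bar>\<xi>\<bar> * cmod \<mu>))"
    by (rule weighted_term_le[OF abs_Im_mult_cnj_le, where c = p])
      (use pos \<sigma> p_\<sigma>_bounds in \<open>auto simp: abs_mult p power2_eq_square\<close>)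
  moreover have "m * (p\<^sup>2 * (\<bar>\<xi>\<bar> * cmod \<mu>)\<^sup>2) \<le> m * (\<bar>\<xi>\<bar> * cmod \<mu>)\<^sup>2"
    by (rule weighted_square_le) (use pos p_\<sigma>_bounds in auto)
  ultimately show ?thesis unfolding eq by linarith
qed

text \<open>
  The term \<open>a \<rho>\<^sub>1 Re (u z\<^sup>*)\<close> cancels the contribution \<open>k a \<xi> Im (z v\<^sup>*)\<close> of \<open>y'\<close>. It could not be absorbed,
  because \<open>z\<close> is in turn estimated in terms of \<open>v\<close>.
\<close>

lemma v_dissipation:
  "p\<^sup>2 * \<sigma>\<^sup>2 * (- k * \<rho>\<^sub>2 * Re (y' * cnj v + y * cnj v') - a * \<rho>\<^sub>1 * Re (u' * cnj z + u * cnj z'))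
    \<le> - k\<^sup>2 * (p * \<sigma> * cmod v)\<^sup>2 + k * \<rho>\<^sub>2 * (p * cmod y)\<^sup>2
      + \<bar>a * \<rho>\<^sub>1 - k * \<rho>\<^sub>2\<bar> * ((p\<^sup>2 * \<sigma> * cmod u) * (p * cmod y))
      + k * m * ((p * \<sigma> * cmod v) * (\<bar>\<xi>\<bar> * cmod \<mu>)) + k * \<delta> * ((p * \<sigma> * cmod v) * (p * cmod \<theta>))"
proof -
  have "- k * \<rho>\<^sub>2 * Re (y' * cnj v + y * cnj v') - a * \<rho>\<^sub>1 * Re (u' * cnj z + u * cnj z')
      = - k * ((\<rho>\<^sub>2 * Re y') * Re v + (\<rho>\<^sub>2 * Im y') * Im v) - k * \<rho>\<^sub>2 * (Re y * Re v' + Im y * Im v')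
        - a * ((\<rho>\<^sub>1 * Re u') * Re z + (\<rho>\<^sub>1 * Im u') * Im z) - a * \<rho>\<^sub>1 * (Re u * Re z' + Im u * Im z')"
    by (simp add: algebra_simps)
  also have "\<dots> = - k\<^sup>2 * (cmod v)\<^sup>2 + k * \<rho>\<^sub>2 * (cmod y)\<^sup>2 + (a * \<rho>\<^sub>1 - k * \<rho>\<^sub>2) * \<xi> * Im (y * cnj u)
      + k * m * \<xi>\<^sup>2 * Re (v * cnj \<mu>) - k * \<delta> * \<xi> * Im (\<theta> * cnj v)"
    unfolding Re_Im_equations v' z' cmod_power2 by (simp add: algebra_simps power2_eq_square)
  finally have "p\<^sup>2 * \<sigma>\<^sup>2 * (- k * \<rho>\<^sub>2 * Re (y' * cnj v + y * cnj v') - a * \<rho>\<^sub>1 * Re (u' * cnj z + u * cnj z'))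
      = p\<^sup>2 * \<sigma>\<^sup>2 * \<dots>" by simp
  also have "\<dots> = - k\<^sup>2 * (p * \<sigma> * cmod v)\<^sup>2 + k * \<rho>\<^sub>2 * (\<sigma>\<^sup>2 * (p * cmod y)\<^sup>2)
      + (p\<^sup>2 * \<sigma>\<^sup>2 * (a * \<rho>\<^sub>1 - k * \<rho>\<^sub>2) * \<xi>) * Im (y * cnj u)
      + (p\<^sup>2 * \<sigma>\<^sup>2 * k * m * \<xi>\<^sup>2) * Re (v * cnj \<mu>) + (- p\<^sup>2 * \<sigma>\<^sup>2 * k * \<delta> * \<xi>) * Im (\<theta> * cnj v)"
    unfolding power_mult_distrib by (simp only: algebra_simps)
  finally have eq: "p\<^sup>2 * \<sigma>\<^sup>2 * (- k * \<rho>\<^sub>2 * Re (y' * cnj v + y * cnj v') - a * \<rho>\<^sub>1 * Re (u' * cnj z + u * cnj z')) = \<dots>" .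
  \<comment> \<open>The critical coupling: \<open>p^2 \<sigma>^2 |\<xi>| = (p^2 \<sigma>) p\<close>
    leaves nothing over, so \<open>c = 1\<close>.\<close>
  have "\<bar>(p\<^sup>2 * \<sigma>\<^sup>2 * (a * \<rho>\<^sub>1 - k * \<rho>\<^sub>2) * \<xi>) * Im (y * cnj u)\<bar>
      \<le> \<bar>a * \<rho>\<^sub>1 - k * \<rho>\<^sub>2\<bar> * ((p\<^sup>2 * \<sigma> * cmod u) * (p * cmod y))"
    by (rule weighted_term_le[OF abs_Im_mult_cnj_le, where c = 1])
      (use pos \<sigma> p_\<sigma>_bounds in \<open>auto simp: abs_mult p power2_eq_square\<close>)
  moreover have "\<bar>(p\<^sup>2 * \<sigma>\<^sup>2 * k * m * \<xi>\<^sup>2) * Re (v * cnj \<mu>)\<bar> \<le> k * m * ((p * \<sigma> * cmod v) * (\<bar>\<xi>\<bar> * cmod \<mu>))"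
    by (rule weighted_term_le[OF abs_Re_mult_cnj_le, where c = "p\<^sup>2"])
      (use pos \<sigma> p_\<sigma>_bounds in \<open>auto simp: abs_mult p power2_eq_square\<close>)
  moreover have "\<bar>(- p\<^sup>2 * \<sigma>\<^sup>2 * k * \<delta> * \<xi>) * Im (\<theta> * cnj v)\<bar> \<le> k * \<delta> * ((p * \<sigma> * cmod v) * (p * cmod \<theta>))"
    by (rule weighted_term_le[OF abs_Im_mult_cnj_le, where c = p])
      (use pos \<sigma> p_\<sigma>_bounds in \<open>auto simp: abs_mult p power2_eq_square\<close>)
  moreover have "k * \<rho>\<^sub>2 * (\<sigma>\<^sup>2 * (p * cmod y)\<^sup>2) \<le> k * \<rho>\<^sub>2 * (p * cmod y)\<^sup>2"
    by (rule weighted_square_le) (use pos p_\<sigma>_bounds in auto)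
  ultimately show ?thesis unfolding eq by linarith
qed

text \<open>\<open>v'\<close> contains \<open>\<i> \<xi> u\<close>. The prefactor
  \<open>p^2 \<sigma>^4 \<xi>\<close> gives \<open>u\<close> the weight
  \<open>p^4 \<sigma>^2\<close>, while the error in \<open>v\<close> gets that same weight and so
  fits under the \<open>p^2 \<sigma>^2\<close> available for \<open>v\<close>.\<close>

lemma u_dissipation:
  "p\<^sup>2 * \<sigma>^4 * (- \<rho>\<^sub>1 * \<xi> * Im (v' * cnj u + v * cnj u'))
    \<le> - \<rho>\<^sub>1 * (p\<^sup>2 * \<sigma> * cmod u)\<^sup>2 + \<rho>\<^sub>1 * ((p\<^sup>2 * \<sigma> * cmod u) * (p * cmod y)) + k * (p * \<sigma> * cmod v)\<^sup>2"
proof -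
  have "- \<rho>\<^sub>1 * Im (v' * cnj u + v * cnj u')
      = - \<rho>\<^sub>1 * (Im v' * Re u - Re v' * Im u) - (Im v * (\<rho>\<^sub>1 * Re u') - Re v * (\<rho>\<^sub>1 * Im u'))"
    by (simp add: algebra_simps)
  also have "\<dots> = - \<rho>\<^sub>1 * \<xi> * (cmod u)\<^sup>2 + \<rho>\<^sub>1 * Im (y * cnj u) + k * \<xi> * (cmod v)\<^sup>2" (is "_ = ?r")
    unfolding Re_Im_equations v' cmod_power2 by (simp add: algebra_simps power2_eq_square)
  finally have id: "- \<rho>\<^sub>1 * Im (v' * cnj u + v * cnj u') = ?r" .
  have "p\<^sup>2 * \<sigma>^4 * (- \<rho>\<^sub>1 * \<xi> * Im (v' * cnj u + v * cnj u')) = p\<^sup>2 * \<sigma>^4 * \<xi> * ?r"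
    unfolding id[symmetric] by (simp only: mult_ac)
  also have "\<dots> = - \<rho>\<^sub>1 * (p\<^sup>2 * \<sigma> * cmod u)\<^sup>2 + (p\<^sup>2 * \<sigma>^4 * \<rho>\<^sub>1 * \<xi>) * Im (y * cnj u)
      + k * (p\<^sup>2 * (p * \<sigma> * cmod v)\<^sup>2)"
    unfolding p power_mult_distrib power2_abs
    by (simp only: algebra_simps power2_eq_square power4_eq_xxxx)
  finally have eq: "p\<^sup>2 * \<sigma>^4 * (- \<rho>\<^sub>1 * \<xi> * Im (v' * cnj u + v * cnj u')) = \<dots>" .
  have "\<bar>(p\<^sup>2 * \<sigma>^4 * \<rho>\<^sub>1 * \<xi>) * Im (y * cnj u)\<bar> \<le> \<rho>\<^sub>1 * ((p\<^sup>2 * \<sigma> * cmod u) * (p * cmod y))"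
    by (rule weighted_term_le[OF abs_Im_mult_cnj_le, where c = "\<sigma>\<^sup>2"])
      (use pos \<sigma> p_\<sigma>_bounds in \<open>auto simp: abs_mult p power2_eq_square power4_eq_xxxx\<close>)
  moreover have "k * (p\<^sup>2 * (p * \<sigma> * cmod v)\<^sup>2) \<le> k * (p * \<sigma> * cmod v)\<^sup>2"
    by (rule weighted_square_le) (use pos p_\<sigma>_bounds in auto)
  ultimately show ?thesis unfolding eq by linarith
qed

text \<open>\<open>\<rho>\<^sub>2 y'\<close> contains \<open>\<i> a \<xi> z\<close>, and
  \<open>p^2 \<sigma>^2 \<xi>^2 = p^4\<close>. The coupling with \<open>v\<close> fixes this weight:
  \<open>p^2 \<sigma>^2 |\<xi>|\<close> is exactly \<open>p^2\<close> for \<open>z\<close> times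
  \<open>p \<sigma>\<close> for \<open>v\<close>.\<close>

lemma z_dissipation:
  "p\<^sup>2 * \<sigma>\<^sup>2 * (- \<rho>\<^sub>2 * \<xi> * Im (y' * cnj z + y * cnj z'))
    \<le> - a * (p\<^sup>2 * cmod z)\<^sup>2 + m * ((p\<^sup>2 * cmod z) * (\<bar>\<xi>\<bar> * cmod \<mu>))
      + k * ((p\<^sup>2 * cmod z) * (p * \<sigma> * cmod v)) + \<delta> * ((p\<^sup>2 * cmod z) * (p * cmod \<theta>))
      + \<rho>\<^sub>2 * (p * cmod y)\<^sup>2"
proof -
  have "- \<rho>\<^sub>2 * Im (y' * cnj z + y * cnj z')
      = - ((\<rho>\<^sub>2 * Im y') * Re z - (\<rho>\<^sub>2 * Re y') * Im z) - \<rho>\<^sub>2 * (Im y * Re z' - Re y * Im z')"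
    by (simp add: algebra_simps)
  also have "\<dots> = - a * \<xi> * (cmod z)\<^sup>2 + m * \<xi>\<^sup>2 * Im (\<mu> * cnj z) - k * Im (v * cnj z)
      + \<delta> * \<xi> * Re (\<theta> * cnj z) + \<rho>\<^sub>2 * \<xi> * (cmod y)\<^sup>2" (is "_ = ?r")
    unfolding Re_Im_equations z' cmod_power2 by (simp add: algebra_simps power2_eq_square)
  finally have id: "- \<rho>\<^sub>2 * Im (y' * cnj z + y * cnj z') = ?r" .
  have "p\<^sup>2 * \<sigma>\<^sup>2 * (- \<rho>\<^sub>2 * \<xi> * Im (y' * cnj z + y * cnj z')) = p\<^sup>2 * \<sigma>\<^sup>2 * \<xi> * ?r"
    unfolding id[symmetric] by (simp only: mult_ac)
  also have "\<dots> = - a * (p\<^sup>2 * cmod z)\<^sup>2 + (p\<^sup>2 * \<sigma>\<^sup>2 * m * \<xi>^3) * Im (\<mu> * cnj z)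
      + (- p\<^sup>2 * \<sigma>\<^sup>2 * k * \<xi>) * Im (v * cnj z)
      + (p\<^sup>2 * \<sigma>\<^sup>2 * \<delta> * \<xi>\<^sup>2) * Re (\<theta> * cnj z) + \<rho>\<^sub>2 * (p\<^sup>2 * (p * cmod y)\<^sup>2)"
    unfolding p power_mult_distrib power2_abs
    by (simp add: algebra_simps power2_eq_square power3_eq_cube)
  finally have eq: "p\<^sup>2 * \<sigma>\<^sup>2 * (- \<rho>\<^sub>2 * \<xi> * Im (y' * cnj z + y * cnj z')) = \<dots>" .
  have "\<bar>(p\<^sup>2 * \<sigma>\<^sup>2 * m * \<xi>^3) * Im (\<mu> * cnj z)\<bar> \<le> m * ((p\<^sup>2 * cmod z) * (\<bar>\<xi>\<bar> * cmod \<mu>))"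
    by (rule weighted_term_le[OF abs_Im_mult_cnj_le, where c = "p\<^sup>2"])
      (use pos \<sigma> p_\<sigma>_bounds in \<open>auto simp: abs_mult p power2_eq_square power3_eq_cube\<close>)
  moreover have "\<bar>(- p\<^sup>2 * \<sigma>\<^sup>2 * k * \<xi>) * Im (v * cnj z)\<bar> \<le> k * ((p\<^sup>2 * cmod z) * (p * \<sigma> * cmod v))"
    by (rule weighted_term_le[OF abs_Im_mult_cnj_le, where c = 1])
      (use pos \<sigma> p_\<sigma>_bounds in \<open>auto simp: abs_mult p power2_eq_square\<close>)
  moreover have "\<bar>(p\<^sup>2 * \<sigma>\<^sup>2 * \<delta> * \<xi>\<^sup>2) * Re (\<theta> * cnj z)\<bar> \<le> \<delta> * ((p\<^sup>2 * cmod z) * (p * cmod \<theta>))"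
    by (rule weighted_term_le[OF abs_Re_mult_cnj_le, where c = p])
      (use pos \<sigma> p_\<sigma>_bounds in \<open>auto simp: abs_mult p power2_eq_square\<close>)
  moreover have "\<rho>\<^sub>2 * (p\<^sup>2 * (p * cmod y)\<^sup>2) \<le> \<rho>\<^sub>2 * (p * cmod y)\<^sup>2"
    by (rule weighted_square_le) (use pos p_\<sigma>_bounds in auto)
  ultimately show ?thesis unfolding eq by linarith
qed

text \<open>Each factor \<open>|\<xi>|\<close> in a multiplier meets a \<open>\<sigma>\<close> and
  becomes \<open>p\<close>. In the pairing with \<open>\<mu>\<close> one \<open>|\<xi>|\<close> is
  instead extracted from \<open>p^2 = p \<sigma> |\<xi>|\<close>, since the energy controls
  \<open>|\<xi>| |\<mu>|\<close> and not \<open>|\<mu>|\<close> uniformly.\<close>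

lemma multiplier_bounds:
  "\<bar>\<sigma>\<^sup>2 * (\<tau> * \<rho>\<^sub>3 * \<xi> * Im (q * cnj \<theta>))\<bar> \<le> \<tau> * \<rho>\<^sub>3 * (cmod q * cmod \<theta>)"
  "\<bar>p\<^sup>2 * (- \<rho>\<^sub>2 * Re (y * cnj \<mu>))\<bar> \<le> \<rho>\<^sub>2 * (cmod y * (\<bar>\<xi>\<bar> * cmod \<mu>))"
  "\<bar>p\<^sup>2 * \<sigma>\<^sup>2 * (- k * \<rho>\<^sub>2 * Re (y * cnj v) - a * \<rho>\<^sub>1 * Re (u * cnj z))\<bar>
    \<le> k * \<rho>\<^sub>2 * (cmod y * cmod v) + a * \<rho>\<^sub>1 * (cmod u * cmod z)"
  "\<bar>p\<^sup>2 * \<sigma>^4 * (- \<rho>\<^sub>1 * \<xi> * Im (v * cnj u))\<bar> \<le> \<rho>\<^sub>1 * (cmod v * cmod u)"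
  "\<bar>p\<^sup>2 * \<sigma>\<^sup>2 * (- \<rho>\<^sub>2 * \<xi> * Im (y * cnj z))\<bar> \<le> \<rho>\<^sub>2 * (cmod y * cmod z)"
proof -
  note b = p_\<sigma>_bounds
  have c: "p * \<sigma> \<le> 1" "p\<^sup>2 * \<sigma>\<^sup>2 \<le> 1" "p ^ 3 * \<sigma> \<le> 1" "p ^ 3 * \<sigma> ^ 3 \<le> 1"
    using b \<sigma> by (auto intro!: mult_le_one power_le_one zero_le_power)
  have "\<bar>(\<sigma>\<^sup>2 * \<tau> * \<rho>\<^sub>3 * \<xi>) * Im (q * cnj \<theta>)\<bar> \<le> \<tau> * \<rho>\<^sub>3 * (cmod q * cmod \<theta>)"
    by (rule weighted_term_le[OF abs_Im_mult_cnj_le _ _ c(1)])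
      (use pos \<sigma> b in \<open>auto simp: abs_mult p power2_eq_square\<close>)
  then show "\<bar>\<sigma>\<^sup>2 * (\<tau> * \<rho>\<^sub>3 * \<xi> * Im (q * cnj \<theta>))\<bar> \<le> \<tau> * \<rho>\<^sub>3 * (cmod q * cmod \<theta>)"
    by (simp only: mult.assoc)
  have "\<bar>(- p\<^sup>2 * \<rho>\<^sub>2) * Re (y * cnj \<mu>)\<bar> \<le> \<rho>\<^sub>2 * (cmod y * (\<bar>\<xi>\<bar> * cmod \<mu>))"
    by (rule weighted_term_le[OF abs_Re_mult_cnj_le _ _ c(1)])
      (use pos \<sigma> b in \<open>auto simp: abs_mult p power2_eq_square\<close>)
  then show "\<bar>p\<^sup>2 * (- \<rho>\<^sub>2 * Re (y * cnj \<mu>))\<bar> \<le> \<rho>\<^sub>2 * (cmod y * (\<bar>\<xi>\<bar> * cmod \<mu>))"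
    by (simp only: mult.assoc mult_minus_left mult_minus_right)
  have "\<bar>(p\<^sup>2 * \<sigma>\<^sup>2 * (k * \<rho>\<^sub>2)) * Re (y * cnj v)\<bar> \<le> k * \<rho>\<^sub>2 * (cmod y * cmod v)"
    by (rule weighted_term_le[OF abs_Re_mult_cnj_le _ _ c(2)]) (use pos \<sigma> b in \<open>auto simp: abs_mult\<close>)
  moreover have "\<bar>(p\<^sup>2 * \<sigma>\<^sup>2 * (a * \<rho>\<^sub>1)) * Re (u * cnj z)\<bar> \<le> a * \<rho>\<^sub>1 * (cmod u * cmod z)"
    by (rule weighted_term_le[OF abs_Re_mult_cnj_le _ _ c(2)]) (use pos \<sigma> b in \<open>auto simp: abs_mult\<close>)
  moreover have "p\<^sup>2 * \<sigma>\<^sup>2 * (- k * \<rho>\<^sub>2 * Re (y * cnj v) - a * \<rho>\<^sub>1 * Re (u * cnj z))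
      = - ((p\<^sup>2 * \<sigma>\<^sup>2 * (k * \<rho>\<^sub>2)) * Re (y * cnj v)) - (p\<^sup>2 * \<sigma>\<^sup>2 * (a * \<rho>\<^sub>1)) * Re (u * cnj z)"
    by algebra
  ultimately show "\<bar>p\<^sup>2 * \<sigma>\<^sup>2 * (- k * \<rho>\<^sub>2 * Re (y * cnj v) - a * \<rho>\<^sub>1 * Re (u * cnj z))\<bar>
    \<le> k * \<rho>\<^sub>2 * (cmod y * cmod v) + a * \<rho>\<^sub>1 * (cmod u * cmod z)" by linarith
  have "\<bar>(p\<^sup>2 * \<sigma>^4 * (- \<rho>\<^sub>1 * \<xi>)) * Im (v * cnj u)\<bar> \<le> \<rho>\<^sub>1 * (cmod v * cmod u)"
    by (rule weighted_term_le[OF abs_Im_mult_cnj_le _ _ c(4)])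
      (use pos \<sigma> b in \<open>auto simp: abs_mult p power2_eq_square power3_eq_cube power4_eq_xxxx\<close>)
  then show "\<bar>p\<^sup>2 * \<sigma>^4 * (- \<rho>\<^sub>1 * \<xi> * Im (v * cnj u))\<bar> \<le> \<rho>\<^sub>1 * (cmod v * cmod u)"
    by (simp only: mult.assoc)
  have "\<bar>(p\<^sup>2 * \<sigma>\<^sup>2 * (- \<rho>\<^sub>2 * \<xi>)) * Im (y * cnj z)\<bar> \<le> \<rho>\<^sub>2 * (cmod y * cmod z)"
    by (rule weighted_term_le[OF abs_Im_mult_cnj_le _ _ c(3)])
      (use pos \<sigma> b in \<open>auto simp: abs_mult p power2_eq_square power3_eq_cube\<close>)
  then show "\<bar>p\<^sup>2 * \<sigma>\<^sup>2 * (- \<rho>\<^sub>2 * \<xi> * Im (y * cnj z))\<bar> \<le> \<rho>\<^sub>2 * (cmod y * cmod z)"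
    by (simp only: mult.assoc)
qed

text \<open>The couplings are skew and cancel in pairs; the memory force in \<open>y'\<close>
  cancels against the production term \<open>2 Re (cnj y * \<mu>)\<close> of \<open>N'\<close>. The
  damping \<open>- k\<^sub>2 N\<close> is added later.\<close>

lemma energy_dissipation:
  "2 * (\<rho>\<^sub>1 * Re (u' * cnj u) + \<rho>\<^sub>2 * Re (y' * cnj y) + \<rho>\<^sub>3 * Re (\<theta>' * cnj \<theta>) + k * Re (v' * cnj v)
      + a * Re (z' * cnj z) + \<tau> * Re (q' * cnj q)) + m * \<xi>\<^sup>2 * (2 * Re (cnj y * \<mu>)) = - 2 * \<beta> * (cmod q)\<^sup>2"
proof -
  have "\<rho>\<^sub>1 * Re (u' * cnj u) + \<rho>\<^sub>2 * Re (y' * cnj y) + \<rho>\<^sub>3 * Re (\<theta>' * cnj \<theta>) + \<tau> * Re (q' * cnj q)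
      = (\<rho>\<^sub>1 * Re u') * Re u + (\<rho>\<^sub>1 * Im u') * Im u + (\<rho>\<^sub>2 * Re y') * Re y + (\<rho>\<^sub>2 * Im y') * Im y
      + (\<rho>\<^sub>3 * Re \<theta>') * Re \<theta> + (\<rho>\<^sub>3 * Im \<theta>') * Im \<theta> + (\<tau> * Re q') * Re q + (\<tau> * Im q') * Im q"
    by (simp add: algebra_simps)
  then show ?thesis
    unfolding Re_Im_equations v' z' cmod_power2 by (simp add: algebra_simps power2_eq_square)
qed

end

section \<open>Absorption of the error terms\<close>

lemma Young_inequality_weighted:
  fixes c e A B :: real
  assumes "0 < e"
  shows "c * (A * B) \<le> e * A\<^sup>2 + c\<^sup>2 / (4 * e) * B\<^sup>2"
proof -
  have "0 \<le> e * (A - c / (2 * e) * B)\<^sup>2" using assms by simp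
  also have "\<dots> = e * A\<^sup>2 + c\<^sup>2 / (4 * e) * B\<^sup>2 - c * (A * B)"
    using assms by (simp add: power2_eq_square field_simps)
  finally show ?thesis by simp
qed

text \<open>
  The weights are chosen in the order \<open>n\<^sub>4 = n\<^sub>5\<close>, \<open>n\<^sub>3\<close>, \<open>n\<^sub>1\<close>, \<open>n\<^sub>2\<close>, \<open>n\<close>, each absorbing the errors of its predecessors;
  the errors it creates in quantities that are already controlled are made small by Young's inequality.
\<close>

lemma dissipation_cascade:
  fixes K :: real
  assumes K: "0 \<le> K"
  obtains n\<^sub>1 n\<^sub>2 n\<^sub>3 n\<^sub>4 n\<^sub>5 n :: real
  where "0 < n\<^sub>1" "0 < n\<^sub>2" "0 < n\<^sub>3" "0 < n\<^sub>4" "0 < n\<^sub>5"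
    and "\<And>D\<^sub>0 D\<^sub>1 D\<^sub>2 D\<^sub>3 D\<^sub>4 D\<^sub>5 A\<^sub>v A\<^sub>u A\<^sub>z A\<^sub>y A\<^sub>\<theta> A\<^sub>q A\<^sub>\<eta> n\<^sub>0 :: real.
      D\<^sub>0 \<le> - (A\<^sub>q\<^sup>2 + A\<^sub>\<eta>\<^sup>2) \<Longrightarrow>
      D\<^sub>1 \<le> - A\<^sub>\<theta>\<^sup>2 + K * (A\<^sub>q * A\<^sub>\<theta> + A\<^sub>q\<^sup>2 + A\<^sub>q * A\<^sub>y) \<Longrightarrow>
      D\<^sub>2 \<le> - A\<^sub>y\<^sup>2 + K * (A\<^sub>y * A\<^sub>\<eta> + A\<^sub>z * A\<^sub>\<eta> + A\<^sub>\<eta>\<^sup>2 + A\<^sub>v * A\<^sub>\<eta> + A\<^sub>\<theta> * A\<^sub>\<eta>) \<Longrightarrow>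
      D\<^sub>3 \<le> - A\<^sub>v\<^sup>2 + K * (A\<^sub>y\<^sup>2 + A\<^sub>u * A\<^sub>y + A\<^sub>v * A\<^sub>\<eta> + A\<^sub>v * A\<^sub>\<theta>) \<Longrightarrow>
      D\<^sub>4 \<le> - A\<^sub>u\<^sup>2 + K * (A\<^sub>u * A\<^sub>y + A\<^sub>v\<^sup>2) \<Longrightarrow>
      D\<^sub>5 \<le> - A\<^sub>z\<^sup>2 + K * (A\<^sub>z * A\<^sub>\<eta> + A\<^sub>z * A\<^sub>v + A\<^sub>z * A\<^sub>\<theta> + A\<^sub>y\<^sup>2) \<Longrightarrow> n \<le> n\<^sub>0 \<Longrightarrow>
      n\<^sub>0 * D\<^sub>0 + n\<^sub>1 * D\<^sub>1 + n\<^sub>2 * D\<^sub>2 + n\<^sub>3 * D\<^sub>3 + n\<^sub>4 * D\<^sub>4 + n\<^sub>5 * D\<^sub>5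
        \<le> - (A\<^sub>v\<^sup>2 + A\<^sub>u\<^sup>2 + A\<^sub>z\<^sup>2 + A\<^sub>y\<^sup>2 + A\<^sub>\<theta>\<^sup>2 + A\<^sub>q\<^sup>2 + A\<^sub>\<eta>\<^sup>2)"
proof -
  \<comment> \<open>Each weight is read off from one column. Half of \<open>n\<^sub>3\<close> and of
    \<open>n\<^sub>1\<close> is spent by Young's inequality in the own row, hence the factors 2. The
    remaining half of \<open>n\<^sub>3\<close> pays \<open>8 * K\<^sup>2\<close> to the
    \<open>D\<^sub>5\<close> row, \<open>4 * K\<close> to the \<open>D\<^sub>4\<close> row, 1 to the
    \<open>D\<^sub>2\<close> row, and leaves 1 for the claim; \<open>n\<^sub>1\<close> is analogous.
    In \<open>n\<^sub>2\<close> the 3 pays the \<open>D\<^sub>1\<close> row, the own row and the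
    claim.\<close>
  define n\<^sub>3 where "n\<^sub>3 = 2 * (8 * K\<^sup>2 + 4 * K + 2)"
  define n\<^sub>1 where "n\<^sub>1 = 2 * (8 * K\<^sup>2 + n\<^sub>3 * K\<^sup>2 + 2)"
  define n\<^sub>2 where "n\<^sub>2 = 3 + 4 * K + 4 * K\<^sup>2 + n\<^sub>3 * K + (n\<^sub>3 * K)\<^sup>2 / 4"
  define n where "n = 1 + 8 * K\<^sup>2 + n\<^sub>3 * K\<^sup>2 + (n\<^sub>2 * K)\<^sup>2 + n\<^sub>2 * K + n\<^sub>1 * K\<^sup>2 / 2 + n\<^sub>1 * K + (n\<^sub>1 * K)\<^sup>2 / 4"
  have pos: "0 < n\<^sub>3" "0 < n\<^sub>1" "0 < n\<^sub>2" "0 \<le> n"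
  proof -
    show 3: "0 < n\<^sub>3" unfolding n\<^sub>3_def using K by (simp add: add_nonneg_pos)
    show 1: "0 < n\<^sub>1" unfolding n\<^sub>1_def using 3 by (simp add: add_nonneg_pos)
    show 2: "0 < n\<^sub>2" unfolding n\<^sub>2_def using K 3 by (simp add: add_pos_nonneg)
    show "0 \<le> n" unfolding n_def using K 1 2 3 by simp
  qed
  show thesis
  \<comment> \<open>The value 4 suffices for \<open>u\<close> and \<open>z\<close>: Young's
    inequality leaves 3 and 5/2 in their own rows, and the other rows take at most 1 more.\<close>
  proof (rule that[of n\<^sub>1 n\<^sub>2 n\<^sub>3 4 4 n])
    fix D\<^sub>0 D\<^sub>1 D\<^sub>2 D\<^sub>3 D\<^sub>4 D\<^sub>5 A\<^sub>v A\<^sub>u A\<^sub>z A\<^sub>y A\<^sub>\<theta> A\<^sub>q A\<^sub>\<eta> n\<^sub>0 :: real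
    assume D0: "D\<^sub>0 \<le> - (A\<^sub>q\<^sup>2 + A\<^sub>\<eta>\<^sup>2)"
      and D1: "D\<^sub>1 \<le> - A\<^sub>\<theta>\<^sup>2 + K * (A\<^sub>q * A\<^sub>\<theta> + A\<^sub>q\<^sup>2 + A\<^sub>q * A\<^sub>y)"
      and D2: "D\<^sub>2 \<le> - A\<^sub>y\<^sup>2 + K * (A\<^sub>y * A\<^sub>\<eta> + A\<^sub>z * A\<^sub>\<eta> + A\<^sub>\<eta>\<^sup>2 + A\<^sub>v * A\<^sub>\<eta> + A\<^sub>\<theta> * A\<^sub>\<eta>)"
      and D3: "D\<^sub>3 \<le> - A\<^sub>v\<^sup>2 + K * (A\<^sub>y\<^sup>2 + A\<^sub>u * A\<^sub>y + A\<^sub>v * A\<^sub>\<eta> + A\<^sub>v * A\<^sub>\<theta>)"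
      and D4: "D\<^sub>4 \<le> - A\<^sub>u\<^sup>2 + K * (A\<^sub>u * A\<^sub>y + A\<^sub>v\<^sup>2)"
      and D5: "D\<^sub>5 \<le> - A\<^sub>z\<^sup>2 + K * (A\<^sub>z * A\<^sub>\<eta> + A\<^sub>z * A\<^sub>v + A\<^sub>z * A\<^sub>\<theta> + A\<^sub>y\<^sup>2)"
      and n0: "n \<le> n\<^sub>0"
    have "n\<^sub>0 * D\<^sub>0 \<le> n\<^sub>0 * - (A\<^sub>q\<^sup>2 + A\<^sub>\<eta>\<^sup>2)"
      using D0 n0 pos by (intro mult_left_mono) auto
    also have "\<dots> \<le> n * - (A\<^sub>q\<^sup>2 + A\<^sub>\<eta>\<^sup>2)"
      using n0 by (intro mult_right_mono_neg) auto
    finally have E0: "n\<^sub>0 * D\<^sub>0 \<le> - n * A\<^sub>q\<^sup>2 - n * A\<^sub>\<eta>\<^sup>2" by (simp add: algebra_simps)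
    have "n\<^sub>1 * D\<^sub>1 \<le> n\<^sub>1 * (- A\<^sub>\<theta>\<^sup>2 + K * (A\<^sub>q * A\<^sub>\<theta> + A\<^sub>q\<^sup>2 + A\<^sub>q * A\<^sub>y))"
      using D1 pos by (intro mult_left_mono) auto
    also have "\<dots> = - n\<^sub>1 * A\<^sub>\<theta>\<^sup>2 + n\<^sub>1 * (K * (A\<^sub>q * A\<^sub>\<theta>)) + n\<^sub>1 * K * A\<^sub>q\<^sup>2 + (n\<^sub>1 * K) * (A\<^sub>y * A\<^sub>q)"
      by (simp add: algebra_simps)
    also have "n\<^sub>1 * (K * (A\<^sub>q * A\<^sub>\<theta>)) \<le> n\<^sub>1 * (1 / 2 * A\<^sub>\<theta>\<^sup>2 + K\<^sup>2 / 2 * A\<^sub>q\<^sup>2)"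
      using Young_inequality_weighted[of "1/2" K A\<^sub>\<theta> A\<^sub>q] pos by (intro mult_left_mono) (auto simp: mult.commute)
    also have "(n\<^sub>1 * K) * (A\<^sub>y * A\<^sub>q) \<le> A\<^sub>y\<^sup>2 + (n\<^sub>1 * K)\<^sup>2 / 4 * A\<^sub>q\<^sup>2"
      using Young_inequality_weighted[of 1 "n\<^sub>1 * K" A\<^sub>y A\<^sub>q] by simp
    finally have E1: "n\<^sub>1 * D\<^sub>1 \<le> - (n\<^sub>1 / 2) * A\<^sub>\<theta>\<^sup>2 + A\<^sub>y\<^sup>2 + (n\<^sub>1 * K\<^sup>2 / 2 + n\<^sub>1 * K + (n\<^sub>1 * K)\<^sup>2 / 4) * A\<^sub>q\<^sup>2"
      by (simp add: algebra_simps)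
    have Y2: "(n\<^sub>2 * K) * (A * A\<^sub>\<eta>) \<le> A\<^sup>2 + (n\<^sub>2 * K)\<^sup>2 / 4 * A\<^sub>\<eta>\<^sup>2" for A
      using Young_inequality_weighted[of 1 "n\<^sub>2 * K" A A\<^sub>\<eta>] by simp
    have "n\<^sub>2 * D\<^sub>2 \<le> n\<^sub>2 * (- A\<^sub>y\<^sup>2 + K * (A\<^sub>y * A\<^sub>\<eta> + A\<^sub>z * A\<^sub>\<eta> + A\<^sub>\<eta>\<^sup>2 + A\<^sub>v * A\<^sub>\<eta> + A\<^sub>\<theta> * A\<^sub>\<eta>))"
      using D2 pos by (intro mult_left_mono) auto
    also have "\<dots> = - n\<^sub>2 * A\<^sub>y\<^sup>2 + n\<^sub>2 * K * A\<^sub>\<eta>\<^sup>2 + (n\<^sub>2 * K) * (A\<^sub>y * A\<^sub>\<eta>) + (n\<^sub>2 * K) * (A\<^sub>z * A\<^sub>\<eta>)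
        + (n\<^sub>2 * K) * (A\<^sub>v * A\<^sub>\<eta>) + (n\<^sub>2 * K) * (A\<^sub>\<theta> * A\<^sub>\<eta>)"
      by (simp add: algebra_simps)
    finally have E2: "n\<^sub>2 * D\<^sub>2 \<le> - n\<^sub>2 * A\<^sub>y\<^sup>2 + A\<^sub>y\<^sup>2 + A\<^sub>z\<^sup>2 + A\<^sub>v\<^sup>2 + A\<^sub>\<theta>\<^sup>2 + (n\<^sub>2 * K + (n\<^sub>2 * K)\<^sup>2) * A\<^sub>\<eta>\<^sup>2"
      using Y2[of A\<^sub>y] Y2[of A\<^sub>z] Y2[of A\<^sub>v] Y2[of A\<^sub>\<theta>] unfolding distrib_right by linarith
    have Y3: "n\<^sub>3 * (K * (A\<^sub>v * B)) \<le> n\<^sub>3 * (1 / 4 * A\<^sub>v\<^sup>2 + K\<^sup>2 * B\<^sup>2)" for B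
      using Young_inequality_weighted[of "1/4" K A\<^sub>v B] pos by (intro mult_left_mono) auto
    have "n\<^sub>3 * D\<^sub>3 \<le> n\<^sub>3 * (- A\<^sub>v\<^sup>2 + K * (A\<^sub>y\<^sup>2 + A\<^sub>u * A\<^sub>y + A\<^sub>v * A\<^sub>\<eta> + A\<^sub>v * A\<^sub>\<theta>))"
      using D3 pos by (intro mult_left_mono) auto
    also have "\<dots> = - n\<^sub>3 * A\<^sub>v\<^sup>2 + n\<^sub>3 * K * A\<^sub>y\<^sup>2 + (n\<^sub>3 * K) * (A\<^sub>u * A\<^sub>y) + n\<^sub>3 * (K * (A\<^sub>v * A\<^sub>\<eta>)) + n\<^sub>3 * (K * (A\<^sub>v * A\<^sub>\<theta>))"
      by (simp add: algebra_simps)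
    also have "(n\<^sub>3 * K) * (A\<^sub>u * A\<^sub>y) \<le> A\<^sub>u\<^sup>2 + (n\<^sub>3 * K)\<^sup>2 / 4 * A\<^sub>y\<^sup>2"
      using Young_inequality_weighted[of 1 "n\<^sub>3 * K" A\<^sub>u A\<^sub>y] by simp
    also note Y3[of A\<^sub>\<eta>]
    also note Y3[of A\<^sub>\<theta>]
    finally have E3: "n\<^sub>3 * D\<^sub>3 \<le> - (n\<^sub>3 / 2) * A\<^sub>v\<^sup>2 + A\<^sub>u\<^sup>2 + (n\<^sub>3 * K + (n\<^sub>3 * K)\<^sup>2 / 4) * A\<^sub>y\<^sup>2
        + n\<^sub>3 * K\<^sup>2 * A\<^sub>\<eta>\<^sup>2 + n\<^sub>3 * K\<^sup>2 * A\<^sub>\<theta>\<^sup>2"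
      by (simp add: algebra_simps)
    have E4: "4 * D\<^sub>4 \<le> - 3 * A\<^sub>u\<^sup>2 + 4 * K\<^sup>2 * A\<^sub>y\<^sup>2 + 4 * K * A\<^sub>v\<^sup>2"
      using D4 Young_inequality_weighted[of "1/4" K A\<^sub>u A\<^sub>y] unfolding distrib_left by simp
    have Y5: "K * (A\<^sub>z * B) \<le> 1 / 8 * A\<^sub>z\<^sup>2 + 2 * K\<^sup>2 * B\<^sup>2" for B
      using Young_inequality_weighted[of "1/8" K A\<^sub>z B] by simp
    have E5: "4 * D\<^sub>5 \<le> - (5 / 2) * A\<^sub>z\<^sup>2 + 8 * K\<^sup>2 * A\<^sub>\<eta>\<^sup>2 + 8 * K\<^sup>2 * A\<^sub>v\<^sup>2 + 8 * K\<^sup>2 * A\<^sub>\<theta>\<^sup>2 + 4 * K * A\<^sub>y\<^sup>2"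
      using D5 Y5[of A\<^sub>\<eta>] Y5[of A\<^sub>v] Y5[of A\<^sub>\<theta>] unfolding distrib_left by simp
    have n3: "(n\<^sub>3 / 2) * A\<^sub>v\<^sup>2 = 8 * K\<^sup>2 * A\<^sub>v\<^sup>2 + 4 * K * A\<^sub>v\<^sup>2 + 2 * A\<^sub>v\<^sup>2"
      unfolding n\<^sub>3_def by (simp add: algebra_simps)
    have n1: "(n\<^sub>1 / 2) * A\<^sub>\<theta>\<^sup>2 = 8 * K\<^sup>2 * A\<^sub>\<theta>\<^sup>2 + n\<^sub>3 * K\<^sup>2 * A\<^sub>\<theta>\<^sup>2 + 2 * A\<^sub>\<theta>\<^sup>2"
      unfolding n\<^sub>1_def by (simp add: algebra_simps)
    have n2: "n\<^sub>2 * A\<^sub>y\<^sup>2 = 3 * A\<^sub>y\<^sup>2 + 4 * K * A\<^sub>y\<^sup>2 + 4 * K\<^sup>2 * A\<^sub>y\<^sup>2 + (n\<^sub>3 * K + (n\<^sub>3 * K)\<^sup>2 / 4) * A\<^sub>y\<^sup>2"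
      unfolding n\<^sub>2_def by (simp add: algebra_simps)
    have nq: "n * A\<^sub>q\<^sup>2 \<ge> A\<^sub>q\<^sup>2 + (n\<^sub>1 * K\<^sup>2 / 2 + n\<^sub>1 * K + (n\<^sub>1 * K)\<^sup>2 / 4) * A\<^sub>q\<^sup>2"
    proof -
      have "1 + (n\<^sub>1 * K\<^sup>2 / 2 + n\<^sub>1 * K + (n\<^sub>1 * K)\<^sup>2 / 4) \<le> n" using pos K by (simp add: n_def)
      from mult_right_mono[OF this, of "A\<^sub>q\<^sup>2"] show ?thesis by (simp add: algebra_simps)
    qed
    have n\<eta>: "n * A\<^sub>\<eta>\<^sup>2 \<ge> A\<^sub>\<eta>\<^sup>2 + 8 * K\<^sup>2 * A\<^sub>\<eta>\<^sup>2 + n\<^sub>3 * K\<^sup>2 * A\<^sub>\<eta>\<^sup>2 + (n\<^sub>2 * K + (n\<^sub>2 * K)\<^sup>2) * A\<^sub>\<eta>\<^sup>2"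
    proof -
      have "1 + 8 * K\<^sup>2 + n\<^sub>3 * K\<^sup>2 + (n\<^sub>2 * K + (n\<^sub>2 * K)\<^sup>2) \<le> n" using pos K by (simp add: n_def)
      from mult_right_mono[OF this, of "A\<^sub>\<eta>\<^sup>2"] show ?thesis by (simp add: algebra_simps)
    qed
    have "0 \<le> A\<^sub>u\<^sup>2" "0 \<le> A\<^sub>z\<^sup>2" by auto
    with E0 E1 E2 E3 E4 E5 n1 n2 n3 nq n\<eta>
    show "n\<^sub>0 * D\<^sub>0 + n\<^sub>1 * D\<^sub>1 + n\<^sub>2 * D\<^sub>2 + n\<^sub>3 * D\<^sub>3 + 4 * D\<^sub>4 + 4 * D\<^sub>5
      \<le> - (A\<^sub>v\<^sup>2 + A\<^sub>u\<^sup>2 + A\<^sub>z\<^sup>2 + A\<^sub>y\<^sup>2 + A\<^sub>\<theta>\<^sup>2 + A\<^sub>q\<^sup>2 + A\<^sub>\<eta>\<^sup>2)"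
      by linarith
  qed (use pos in auto)
qed

section \<open>Decay of the energy\<close>

lemma mult_le_sum_squares: "x * y \<le> x\<^sup>2 + (y::real)\<^sup>2"
  using sum_squares_bound[of x y] zero_le_power2[of x] zero_le_power2[of y] by linarith

theorem theorem3p2:
  fixes \<rho>\<^sub>1 \<rho>\<^sub>2 \<rho>\<^sub>3 k b m \<delta> \<beta> \<tau> b\<^sub>0 a k\<^sub>1 k\<^sub>2 \<chi>\<^sub>0 :: real
    and g g' :: "real \<Rightarrow> real"
  assumes "\<rho>\<^sub>1 > 0" "\<rho>\<^sub>2 > 0" "\<rho>\<^sub>3 > 0" "k > 0" "b > 0" "m > 0" "\<delta> > 0" "\<beta> > 0" "\<tau> > 0"
    and "\<And>s. s \<ge> 0 \<Longrightarrow> (g has_real_derivative g' s) (at s within {0..})"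
    and "\<exists>s\<ge>0. g s \<noteq> 0"
    and "\<And>s. s \<ge> 0 \<Longrightarrow> g s \<ge> 0"
    and "k\<^sub>1 > 0" "k\<^sub>2 > 0"
    and "\<And>s. s \<ge> 0 \<Longrightarrow> - k\<^sub>1 * g s \<le> g' s \<and> g' s \<le> - k\<^sub>2 * g s"
    and "b\<^sub>0 = (LINT s:{0..}|lborel. g s)"
    and "a = b - b\<^sub>0" "a > 0"
    and "\<chi>\<^sub>0 = stability_number \<rho>\<^sub>1 \<rho>\<^sub>2 \<rho>\<^sub>3 k b \<delta> \<tau>"
  shows "\<exists>C>0. \<exists>c>0. \<forall>\<xi> v u z y \<theta> q \<eta>.
           timoshenko_cattaneo_solution \<rho>\<^sub>1 \<rho>\<^sub>2 \<rho>\<^sub>3 k a m \<delta> \<beta> \<tau> g \<xi> v u z y \<theta> q \<eta> \<longrightarrow>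
           (\<forall>t\<ge>0. timoshenko_cattaneo_energy \<rho>\<^sub>1 \<rho>\<^sub>2 \<rho>\<^sub>3 k a m \<tau> g \<xi> v u z y \<theta> q \<eta> t
              \<le> C * exp (- c * decay_rate \<chi>\<^sub>0 \<xi> * t)
                  * timoshenko_cattaneo_energy \<rho>\<^sub>1 \<rho>\<^sub>2 \<rho>\<^sub>3 k a m \<tau> g \<xi> v u z y \<theta> q \<eta> 0)"
proof -
  interpret memory_kernel g g' k\<^sub>1 k\<^sub>2
    by unfold_locales (use assms in auto)
  note pos = \<open>\<rho>\<^sub>1 > 0\<close> \<open>\<rho>\<^sub>2 > 0\<close> \<open>\<rho>\<^sub>3 > 0\<close> \<open>k > 0\<close> \<open>a > 0\<close> \<open>m > 0\<close> \<open>\<delta> > 0\<close> \<open>\<beta> > 0\<close> \<open>\<tau> > 0\<close>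

  \<comment> \<open>Constants independent of the frequency and of the solution\<close>
  have b\<^sub>0_pos: "0 < b\<^sub>0" using integral_pos assms(16) by simp
  \<comment> \<open>\<open>\<kappa>\<close> exceeds both \<open>sqrt b\<^sub>0\<close>, the constant
    for \<open>\<mu>\<close>, and \<open>k\<^sub>1 * sqrt b\<^sub>0\<close>, the constant for
    \<open>R\<close>.\<close>
  define \<kappa> where "\<kappa> = (1 + k\<^sub>1) * sqrt b\<^sub>0"
  have \<kappa>: "0 \<le> \<kappa>" using k\<^sub>1_pos b\<^sub>0_pos by (simp add: \<kappa>_def)
  \<comment> \<open>The smallest leading coefficient in the five multiplier estimates and the energy
    identity.\<close>
  define c\<^sub>0 where "c\<^sub>0 = Min {\<rho>\<^sub>3, \<rho>\<^sub>2 * b\<^sub>0, k\<^sup>2, \<rho>\<^sub>1, a, 2 * \<beta>, m * k\<^sub>2}"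
  have c\<^sub>0: "0 < c\<^sub>0" "c\<^sub>0 \<le> \<rho>\<^sub>3" "c\<^sub>0 \<le> \<rho>\<^sub>2 * b\<^sub>0" "c\<^sub>0 \<le> k\<^sup>2" "c\<^sub>0 \<le> \<rho>\<^sub>1" "c\<^sub>0 \<le> a" "c\<^sub>0 \<le> 2 * \<beta>" "c\<^sub>0 \<le> m * k\<^sub>2"
  proof -
    show "0 < c\<^sub>0" unfolding c\<^sub>0_def using pos b\<^sub>0_pos k\<^sub>2_pos by (subst Min_gr_iff) simp_all
  qed (unfold c\<^sub>0_def, (rule Min_le; simp)+)
  \<comment> \<open>The sum of all error coefficients. The factor
    \<open>(1 + \<kappa>)\<^sup>2\<close> also covers errors in which \<open>\<mu>\<close> or
    \<open>R\<close> is replaced by its bound once or twice.\<close>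
  define K where "K = (\<rho>\<^sub>1 + \<rho>\<^sub>2 + a + m + k + \<delta> + \<tau> + \<rho>\<^sub>3 * \<beta> + \<tau> * \<delta> + k * \<rho>\<^sub>2 + k * m + k * \<delta> + \<bar>a * \<rho>\<^sub>1 - k * \<rho>\<^sub>2\<bar>) * (1 + \<kappa>)\<^sup>2"
  have K_ge: "C \<le> K" "C * \<kappa> \<le> K" "C * \<kappa>\<^sup>2 \<le> K"
    if "C \<in> {\<rho>\<^sub>1, \<rho>\<^sub>2, a, m, k, \<delta>, \<tau>, \<rho>\<^sub>3 * \<beta>, \<tau> * \<delta>, k * \<rho>\<^sub>2, k * m, k * \<delta>, \<bar>a * \<rho>\<^sub>1 - k * \<rho>\<^sub>2\<bar>}" for C
  proof -
    define s where "s = \<rho>\<^sub>1 + \<rho>\<^sub>2 + a + m + k + \<delta> + \<tau> + \<rho>\<^sub>3 * \<beta> + \<tau> * \<delta> + k * \<rho>\<^sub>2 + k * m + k * \<delta> + \<bar>a * \<rho>\<^sub>1 - k * \<rho>\<^sub>2\<bar>"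
    have "0 < \<rho>\<^sub>3 * \<beta>" "0 < \<tau> * \<delta>" "0 < k * \<rho>\<^sub>2" "0 < k * m" "0 < k * \<delta>" using pos by simp_all
    then have s: "C \<le> s" "0 \<le> s" "0 \<le> C" using that pos unfolding s_def by auto
    have K: "K = s * (1 + \<kappa>)\<^sup>2" by (simp only: K_def s_def)
    have "x \<le> (1 + \<kappa>)\<^sup>2" if "x \<in> {1, \<kappa>, \<kappa>\<^sup>2}" for x
      using that \<kappa> zero_le_power2[of \<kappa>] unfolding power2_sum by auto
    then have "C * x \<le> K" if "x \<in> {1, \<kappa>, \<kappa>\<^sup>2}" for x
      unfolding K using s that \<kappa> by (intro mult_mono) auto
    from this[of 1] this[of \<kappa>] this[of "\<kappa>\<^sup>2"] show "C \<le> K" "C * \<kappa> \<le> K" "C * \<kappa>\<^sup>2 \<le> K" by auto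
  qed
  have K: "0 \<le> K" using K_ge(1)[of \<rho>\<^sub>1] pos by simp
  have "0 \<le> K / c\<^sub>0" using K c\<^sub>0(1) by simp
  show ?thesis
  proof (rule dissipation_cascade[OF \<open>0 \<le> K / c\<^sub>0\<close>], goal_cases)
    case (1 n\<^sub>1 n\<^sub>2 n\<^sub>3 n\<^sub>4 n\<^sub>5 n)
    note n = 1(1-5) and cascade = 1(6)
    define e\<^sub>0 where "e\<^sub>0 = Min {\<rho>\<^sub>1, \<rho>\<^sub>2, \<rho>\<^sub>3, k, a, \<tau>, m}"
    have e\<^sub>0: "0 < e\<^sub>0" "e\<^sub>0 \<le> \<rho>\<^sub>1" "e\<^sub>0 \<le> \<rho>\<^sub>2" "e\<^sub>0 \<le> \<rho>\<^sub>3" "e\<^sub>0 \<le> k" "e\<^sub>0 \<le> a" "e\<^sub>0 \<le> \<tau>" "e\<^sub>0 \<le> m"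
    proof -
      show "0 < e\<^sub>0" unfolding e\<^sub>0_def using pos by (subst Min_gr_iff) simp_all
    qed (unfold e\<^sub>0_def, (rule Min_le; simp)+)
    define e\<^sub>1 where "e\<^sub>1 = Max {\<rho>\<^sub>1, \<rho>\<^sub>2, \<rho>\<^sub>3, k, a, \<tau>, m}"
    have e\<^sub>1: "\<rho>\<^sub>1 \<le> e\<^sub>1" "\<rho>\<^sub>2 \<le> e\<^sub>1" "\<rho>\<^sub>3 \<le> e\<^sub>1" "k \<le> e\<^sub>1" "a \<le> e\<^sub>1" "\<tau> \<le> e\<^sub>1" "m \<le> e\<^sub>1"
      unfolding e\<^sub>1_def by (rule Max_ge; simp)+
    have e\<^sub>1_pos: "0 < e\<^sub>1" using e\<^sub>1(1) pos by linarith
    define G where "G = n\<^sub>1 * (\<tau> * \<rho>\<^sub>3) + n\<^sub>2 * (\<rho>\<^sub>2 * \<kappa>) + n\<^sub>3 * (k * \<rho>\<^sub>2 + a * \<rho>\<^sub>1) + n\<^sub>4 * \<rho>\<^sub>1 + n\<^sub>5 * \<rho>\<^sub>2"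
    \<comment> \<open>Two demands: at least \<open>n\<close> for the absorption, and large enough
      that \<open>\<bar>J\<bar> \<le> G * S\<close> is at most half of
      \<open>n\<^sub>0 * E\<close>.\<close>
    define n\<^sub>0 where "n\<^sub>0 = max n (max 1 (2 * G / e\<^sub>0))"
    have n\<^sub>0: "n \<le> n\<^sub>0" "0 < n\<^sub>0" "G \<le> n\<^sub>0 / 2 * e\<^sub>0"
    proof -
      show "n \<le> n\<^sub>0" "0 < n\<^sub>0" by (auto simp: n\<^sub>0_def)
      have "2 * G / e\<^sub>0 \<le> n\<^sub>0" by (simp add: n\<^sub>0_def)
      then show "G \<le> n\<^sub>0 / 2 * e\<^sub>0" using e\<^sub>0(1) by (simp add: field_simps)
    qed
    \<comment> \<open>\<open>L \<le> 2 * n\<^sub>0 * e\<^sub>1 * S\<close>, while the derivative of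
      \<open>L\<close> is at most \<open>- c\<^sub>0 * r * S\<close>.\<close>
    define c where "c = c\<^sub>0 / (2 * n\<^sub>0 * e\<^sub>1)"
    have c: "0 < c" using c\<^sub>0 n\<^sub>0 e\<^sub>1_pos by (simp add: c_def)
    show ?case
    \<comment> \<open>4 is the ratio of the bounds
      \<open>n\<^sub>0 / 2 * E \<le> L \<le> 2 * n\<^sub>0 * E\<close>.\<close>
    proof (rule exI[of _ 4], rule conjI[OF zero_less_numeral], rule exI[of _ c], rule conjI[OF c], intro allI impI)
      fix \<xi> :: real and v u z y \<theta> q \<eta> and t :: real
      assume sol: "timoshenko_cattaneo_solution \<rho>\<^sub>1 \<rho>\<^sub>2 \<rho>\<^sub>3 k a m \<delta> \<beta> \<tau> g \<xi> v u z y \<theta> q \<eta>"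
        and t: "0 \<le> t"
      define E where "E = timoshenko_cattaneo_energy \<rho>\<^sub>1 \<rho>\<^sub>2 \<rho>\<^sub>3 k a m \<tau> g \<xi> v u z y \<theta> q \<eta>"
      define \<mu> where "\<mu> = (\<lambda>t. LINT s:{0..}|lborel. of_real (g s) * \<eta> t s)"
      define N where "N = (\<lambda>t. LINT s:{0..}|lborel. g s * (cmod (\<eta> t s))\<^sup>2)"
      have E: "E = (\<lambda>t. \<rho>\<^sub>1 * (cmod (u t))\<^sup>2 + \<rho>\<^sub>2 * (cmod (y t))\<^sup>2 + \<rho>\<^sub>3 * (cmod (\<theta> t))\<^sup>2 + k * (cmod (v t))\<^sup>2
          + a * (cmod (z t))\<^sup>2 + \<tau> * (cmod (q t))\<^sup>2 + m * \<xi>\<^sup>2 * N t)"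
        by (simp add: E_def timoshenko_cattaneo_energy_def N_def fun_eq_iff)
      note sol' = sol[unfolded timoshenko_cattaneo_solution_def]
      have cont_y: "continuous_on {0..} y"
        using sol' has_vector_derivative_continuous
        by (fastforce simp: continuous_on_eq_continuous_within)
      note hist = history_functionals[of \<eta> y _ b\<^sub>0 \<mu> N, OF _ _ _ _ cont_y _ assms(16) \<mu>_def N_def]
      have hist: "\<exists>R. (\<mu> has_vector_derivative b\<^sub>0 * y t + R) (at t within {0..}) \<and> (cmod R)\<^sup>2 \<le> k\<^sub>1\<^sup>2 * (b\<^sub>0 * N t)"
        "\<exists>N'. (N has_real_derivative N') (at t within {0..}) \<and> N' \<le> 2 * Re (cnj (y t) * \<mu> t) - k\<^sub>2 * N t"
        "(cmod (\<mu> t))\<^sup>2 \<le> b\<^sub>0 * N t" "0 \<le> N t" if "0 \<le> t" for t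
        by (rule hist; use sol' that in blast)+

      \<comment> \<open>Frequency weights and the decay rate\<close>
      define \<sigma> where "\<sigma> = 1 / sqrt (1 + \<xi>\<^sup>2)"
      define p where "p = \<bar>\<xi>\<bar> * \<sigma>"
      have \<xi>_pos: "0 < 1 + \<xi>\<^sup>2" by (simp add: add_pos_nonneg)
      have \<sigma>: "0 < \<sigma>" using \<xi>_pos by (simp add: \<sigma>_def)
      have \<sigma>2: "\<sigma>\<^sup>2 = 1 / (1 + \<xi>\<^sup>2)" using \<xi>_pos by (simp add: \<sigma>_def power_divide)
      have p2: "p\<^sup>2 = \<xi>\<^sup>2 / (1 + \<xi>\<^sup>2)" by (simp add: p_def power_mult_distrib \<sigma>2)
      have circle: "p\<^sup>2 + \<sigma>\<^sup>2 = 1" unfolding \<sigma>2 p2 using \<xi>_pos by (simp add: field_simps)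
      have p01: "0 \<le> p" "p\<^sup>2 \<le> 1" "\<sigma>\<^sup>2 \<le> 1"
      proof -
        show "0 \<le> p" using \<sigma> by (simp add: p_def)
        show "p\<^sup>2 \<le> 1" "\<sigma>\<^sup>2 \<le> 1"
          using circle zero_le_power2[of p] zero_le_power2[of \<sigma>] by linarith+
      qed
      define r where "r = p ^ 4 * \<sigma>\<^sup>2"
      have r_nonneg: "0 \<le> r" by (simp add: r_def)
      have rate: "decay_rate \<chi>\<^sub>0 \<xi> \<le> r"
      proof -
        have "r = (p\<^sup>2)\<^sup>2 * \<sigma>\<^sup>2" by (simp add: r_def)
        also have "\<dots> = \<xi> ^ 4 / (1 + \<xi>\<^sup>2) ^ 3"
          unfolding p2 \<sigma>2 by (simp add: power_divide power2_eq_square power3_eq_cube power4_eq_xxxx)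
        finally have r: "r = \<xi> ^ 4 / (1 + \<xi>\<^sup>2) ^ 3" .
        have "\<xi> ^ 4 / (1 + \<xi>\<^sup>2) ^ 4 \<le> \<xi> ^ 4 / (1 + \<xi>\<^sup>2) ^ 3"
          using \<xi>_pos by (intro divide_left_mono mult_pos_pos zero_less_power power_increasing) auto
        then show ?thesis by (simp add: decay_rate_def r)
      qed

      \<comment> \<open>Lyapunov functional\<close>
      define S where "S t = (cmod (v t))\<^sup>2 + (cmod (u t))\<^sup>2 + (cmod (z t))\<^sup>2 + (cmod (y t))\<^sup>2 + (cmod (\<theta> t))\<^sup>2
        + (cmod (q t))\<^sup>2 + \<xi>\<^sup>2 * N t" for t
      have E_S: "e\<^sub>0 * S t \<le> E t" "E t \<le> e\<^sub>1 * S t" if "0 \<le> t" for t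
      proof -
        have N: "0 \<le> \<xi>\<^sup>2 * N t" using hist(4)[OF that] by simp
        show "e\<^sub>0 * S t \<le> E t"
          unfolding S_def E distrib_left mult.assoc
          using e\<^sub>0 N by (smt (verit) mult_right_mono zero_le_power2)
        show "E t \<le> e\<^sub>1 * S t"
          unfolding S_def E distrib_left mult.assoc
          using e\<^sub>1 N by (smt (verit) mult_right_mono zero_le_power2)
      qed
      define J where "J t = n\<^sub>1 * (\<sigma>\<^sup>2 * (\<tau> * \<rho>\<^sub>3 * \<xi> * Im (q t * cnj (\<theta> t))))
        + n\<^sub>2 * (p\<^sup>2 * (- \<rho>\<^sub>2 * Re (y t * cnj (\<mu> t))))
        + n\<^sub>3 * (p\<^sup>2 * \<sigma>\<^sup>2 * (- k * \<rho>\<^sub>2 * Re (y t * cnj (v t)) - a * \<rho>\<^sub>1 * Re (u t * cnj (z t))))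
        + n\<^sub>4 * (p\<^sup>2 * \<sigma>^4 * (- \<rho>\<^sub>1 * \<xi> * Im (v t * cnj (u t))))
        + n\<^sub>5 * (p\<^sup>2 * \<sigma>\<^sup>2 * (- \<rho>\<^sub>2 * \<xi> * Im (y t * cnj (z t))))" for t
      define L where "L t = n\<^sub>0 * E t + J t" for t
      have key: "\<bar>J t\<bar> \<le> n\<^sub>0 / 2 * E t \<and> (\<exists>d. (L has_real_derivative d) (at t within {0..}) \<and> d \<le> - (c * r) * L t)"
        if t: "0 \<le> t" for t
      proof -
        have \<mu>_t: "(LINT s:{0..}|lborel. of_real (g s) * \<eta> t s) = \<mu> t" by (simp add: \<mu>_def)
        obtain v' u' z' y' \<theta>' q' where
          d: "(v has_vector_derivative v') (at t within {0..})" "(u has_vector_derivative u') (at t within {0..})"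
            "(z has_vector_derivative z') (at t within {0..})" "(y has_vector_derivative y') (at t within {0..})"
            "(\<theta> has_vector_derivative \<theta>') (at t within {0..})" "(q has_vector_derivative q') (at t within {0..})"
          and e: "v' - \<i> * of_real \<xi> * u t + y t = 0"
            "of_real \<rho>\<^sub>1 * u' - \<i> * of_real k * of_real \<xi> * v t = 0"
            "z' - \<i> * of_real \<xi> * y t = 0"
            "of_real \<rho>\<^sub>2 * y' - \<i> * of_real a * of_real \<xi> * z t + of_real m * (of_real \<xi>)\<^sup>2 * \<mu> t
              - of_real k * v t + \<i> * of_real \<delta> * of_real \<xi> * \<theta> t = 0"
            "of_real \<rho>\<^sub>3 * \<theta>' + \<i> * of_real \<xi> * q t + \<i> * of_real \<delta> * of_real \<xi> * y t = 0"
            "of_real \<tau> * q' + of_real \<beta> * q t + \<i> * of_real \<xi> * \<theta> t = 0"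
          using sol'[THEN conjunct1, rule_format, OF t] unfolding \<mu>_t
          by (elim exE conjE) (rule that)
        obtain R where R: "(\<mu> has_vector_derivative b\<^sub>0 * y t + R) (at t within {0..})" "(cmod R)\<^sup>2 \<le> k\<^sub>1\<^sup>2 * (b\<^sub>0 * N t)"
          using hist(1)[OF t] by blast
        obtain N' where N': "(N has_real_derivative N') (at t within {0..})" "N' \<le> 2 * Re (cnj (y t) * \<mu> t) - k\<^sub>2 * N t"
          using hist(2)[OF t] by blast
        have "v' = \<i> * of_real \<xi> * u t - y t"
          "of_real \<rho>\<^sub>1 * u' = \<i> * of_real k * of_real \<xi> * v t"
          "z' = \<i> * of_real \<xi> * y t"
          "of_real \<rho>\<^sub>2 * y' = \<i> * of_real a * of_real \<xi> * z t - of_real m * (of_real \<xi>)\<^sup>2 * \<mu> t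
            + of_real k * v t - \<i> * of_real \<delta> * of_real \<xi> * \<theta> t"
          "of_real \<rho>\<^sub>3 * \<theta>' = - \<i> * of_real \<xi> * q t - \<i> * of_real \<delta> * of_real \<xi> * y t"
          "of_real \<tau> * q' = - of_real \<beta> * q t - \<i> * of_real \<xi> * \<theta> t"
          using e by algebra+
        note sys = pos \<sigma> p_def circle this refl[of "of_real b\<^sub>0 * y t + R"]
        define A\<^sub>\<eta> where "A\<^sub>\<eta> = \<bar>\<xi>\<bar> * sqrt (N t)"
        have A\<^sub>\<eta>: "0 \<le> A\<^sub>\<eta>" "A\<^sub>\<eta>\<^sup>2 = \<xi>\<^sup>2 * N t"
          using hist(4)[OF t] by (auto simp: A\<^sub>\<eta>_def power_mult_distrib)
        have \<mu>_le: "\<bar>\<xi>\<bar> * cmod (\<mu> t) \<le> \<kappa> * A\<^sub>\<eta>" and R_le: "\<bar>\<xi>\<bar> * cmod R \<le> \<kappa> * A\<^sub>\<eta>"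
        proof -
          have "cmod (\<mu> t) \<le> sqrt b\<^sub>0 * sqrt (N t)"
            using hist(3)[OF t] by (simp add: real_le_rsqrt flip: real_sqrt_mult)
          moreover have "cmod R \<le> k\<^sub>1 * (sqrt b\<^sub>0 * sqrt (N t))"
            using real_le_rsqrt[OF R(2)] k\<^sub>1_pos by (simp add: real_sqrt_mult)
          moreover have "0 \<le> sqrt b\<^sub>0 * sqrt (N t)" "0 \<le> k\<^sub>1 * (sqrt b\<^sub>0 * sqrt (N t))"
            using hist(4)[OF t] b\<^sub>0_pos k\<^sub>1_pos by auto
          moreover have "\<kappa> * A\<^sub>\<eta> = \<bar>\<xi>\<bar> * (sqrt b\<^sub>0 * sqrt (N t) + k\<^sub>1 * (sqrt b\<^sub>0 * sqrt (N t)))"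
            by (simp add: \<kappa>_def A\<^sub>\<eta>_def algebra_simps)
          ultimately show "\<bar>\<xi>\<bar> * cmod (\<mu> t) \<le> \<kappa> * A\<^sub>\<eta>" "\<bar>\<xi>\<bar> * cmod R \<le> \<kappa> * A\<^sub>\<eta>"
            by (auto intro!: mult_left_mono)
        qed
        define A\<^sub>v A\<^sub>u A\<^sub>z A\<^sub>y A\<^sub>\<theta> A\<^sub>q where "A\<^sub>v = p * \<sigma> * cmod (v t)" and "A\<^sub>u = p\<^sup>2 * \<sigma> * cmod (u t)"
          and "A\<^sub>z = p\<^sup>2 * cmod (z t)" and "A\<^sub>y = p * cmod (y t)" and "A\<^sub>\<theta> = p * cmod (\<theta> t)" and "A\<^sub>q = cmod (q t)"
        note A_defs = A\<^sub>v_def A\<^sub>u_def A\<^sub>z_def A\<^sub>y_def A\<^sub>\<theta>_def A\<^sub>q_def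
        have A: "0 \<le> A\<^sub>v" "0 \<le> A\<^sub>u" "0 \<le> A\<^sub>z" "0 \<le> A\<^sub>y" "0 \<le> A\<^sub>\<theta>" "0 \<le> A\<^sub>q"
          using p01 \<sigma> by (simp_all add: A_defs)
        have le: "C * (X * Y) \<le> K * (X * Y)" "C * X\<^sup>2 \<le> K * X\<^sup>2"
          if "C \<in> {\<rho>\<^sub>1, \<rho>\<^sub>2, a, m, k, \<delta>, \<tau>, \<rho>\<^sub>3 * \<beta>, \<tau> * \<delta>, k * \<rho>\<^sub>2, k * m, k * \<delta>, \<bar>a * \<rho>\<^sub>1 - k * \<rho>\<^sub>2\<bar>}"
            "0 \<le> X" "0 \<le> Y" for C X Y
          using K_ge(1)[OF that(1)] that(2,3) by (auto intro: mult_right_mono)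
        have le_\<eta>: "C * (X * W) \<le> K * (X * A\<^sub>\<eta>)"
          if C: "C \<in> {\<rho>\<^sub>2, a, m, k, \<delta>, k * m}" and X: "0 \<le> X" and W: "W \<le> \<kappa> * A\<^sub>\<eta>" for C X W
        proof -
          have "0 \<le> C" using C pos by auto
          then have "C * (X * W) \<le> C * (X * (\<kappa> * A\<^sub>\<eta>))" using X W by (intro mult_left_mono) auto
          also have "\<dots> = (C * \<kappa>) * (X * A\<^sub>\<eta>)" by simp
          also have "\<dots> \<le> K * (X * A\<^sub>\<eta>)" using K_ge(2)[of C] C X A\<^sub>\<eta> by (intro mult_right_mono) auto
          finally show ?thesis .
        qed
        have le_\<eta>\<eta>: "m * (\<bar>\<xi>\<bar> * cmod (\<mu> t))\<^sup>2 \<le> K * A\<^sub>\<eta>\<^sup>2"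
        proof -
          have "m * (\<bar>\<xi>\<bar> * cmod (\<mu> t))\<^sup>2 \<le> m * (\<kappa> * A\<^sub>\<eta>)\<^sup>2"
            using \<mu>_le pos by (intro mult_left_mono power_mono) auto
          also have "\<dots> = (m * \<kappa>\<^sup>2) * A\<^sub>\<eta>\<^sup>2" by (simp add: power_mult_distrib)
          also have "\<dots> \<le> K * A\<^sub>\<eta>\<^sup>2" using K_ge(3)[of m] by (intro mult_right_mono) auto
          finally show ?thesis .
        qed
        have lead: "- C * X\<^sup>2 \<le> - c\<^sub>0 * X\<^sup>2" if "c\<^sub>0 \<le> C" for C X
          using mult_right_mono[OF that zero_le_power2[of X]] by simp

        \<comment> \<open>Derivative of the Lyapunov functional\<close>
        define D\<^sub>1 where "D\<^sub>1 = \<sigma>\<^sup>2 * (\<tau> * \<rho>\<^sub>3 * \<xi> * Im (q' * cnj (\<theta> t) + q t * cnj \<theta>'))"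
        define D\<^sub>2 where "D\<^sub>2 = p\<^sup>2 * (- \<rho>\<^sub>2 * Re (y' * cnj (\<mu> t) + y t * cnj (of_real b\<^sub>0 * y t + R)))"
        define D\<^sub>3 where "D\<^sub>3 = p\<^sup>2 * \<sigma>\<^sup>2 * (- k * \<rho>\<^sub>2 * Re (y' * cnj (v t) + y t * cnj v') - a * \<rho>\<^sub>1 * Re (u' * cnj (z t) + u t * cnj z'))"
        define D\<^sub>4 where "D\<^sub>4 = p\<^sup>2 * \<sigma>^4 * (- \<rho>\<^sub>1 * \<xi> * Im (v' * cnj (u t) + v t * cnj u'))"
        define D\<^sub>5 where "D\<^sub>5 = p\<^sup>2 * \<sigma>\<^sup>2 * (- \<rho>\<^sub>2 * \<xi> * Im (y' * cnj (z t) + y t * cnj z'))"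
        define D\<^sub>0 where "D\<^sub>0 = \<rho>\<^sub>1 * (2 * Re (u' * cnj (u t))) + \<rho>\<^sub>2 * (2 * Re (y' * cnj (y t))) + \<rho>\<^sub>3 * (2 * Re (\<theta>' * cnj (\<theta> t)))
          + k * (2 * Re (v' * cnj (v t))) + a * (2 * Re (z' * cnj (z t))) + \<tau> * (2 * Re (q' * cnj (q t))) + m * \<xi>\<^sup>2 * N'"
        have "(E has_real_derivative D\<^sub>0) (at t within {0..})"
          unfolding E D\<^sub>0_def
          by (intro DERIV_add DERIV_cmult has_real_derivative_cmod_power2 d N')
        moreover have "(J has_real_derivative n\<^sub>1 * D\<^sub>1 + n\<^sub>2 * D\<^sub>2 + n\<^sub>3 * D\<^sub>3 + n\<^sub>4 * D\<^sub>4 + n\<^sub>5 * D\<^sub>5) (at t within {0..})"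
          unfolding J_def[abs_def] D\<^sub>1_def D\<^sub>2_def D\<^sub>3_def D\<^sub>4_def D\<^sub>5_def
          by (intro DERIV_add DERIV_diff DERIV_cmult has_real_derivative_Re_mult_cnj has_real_derivative_Im_mult_cnj d R)
        ultimately have dL: "(L has_real_derivative n\<^sub>0 * D\<^sub>0 + (n\<^sub>1 * D\<^sub>1 + n\<^sub>2 * D\<^sub>2 + n\<^sub>3 * D\<^sub>3 + n\<^sub>4 * D\<^sub>4 + n\<^sub>5 * D\<^sub>5)) (at t within {0..})"
          unfolding L_def[abs_def] by (intro DERIV_add DERIV_cmult)

        have D0_le: "D\<^sub>0 \<le> - c\<^sub>0 * (A\<^sub>q\<^sup>2 + A\<^sub>\<eta>\<^sup>2)"
        proof -
          have "m * \<xi>\<^sup>2 * N' \<le> m * \<xi>\<^sup>2 * (2 * Re (cnj (y t) * \<mu> t) - k\<^sub>2 * N t)"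
            using N'(2) pos by (intro mult_left_mono) auto
          also have "\<dots> = m * \<xi>\<^sup>2 * (2 * Re (cnj (y t) * \<mu> t)) - m * k\<^sub>2 * A\<^sub>\<eta>\<^sup>2"
            unfolding A\<^sub>\<eta> right_diff_distrib by (simp only: mult_ac)
          finally have "D\<^sub>0 \<le> - 2 * \<beta> * A\<^sub>q\<^sup>2 - m * k\<^sub>2 * A\<^sub>\<eta>\<^sup>2"
            using energy_dissipation[OF sys] unfolding D\<^sub>0_def A\<^sub>q_def by argo
          then show ?thesis
            using lead[OF c\<^sub>0(7), of A\<^sub>q] lead[OF c\<^sub>0(8), of A\<^sub>\<eta>] unfolding distrib_left by simp
        qed
        have D1_le: "D\<^sub>1 \<le> - c\<^sub>0 * A\<^sub>\<theta>\<^sup>2 + K * (A\<^sub>q * A\<^sub>\<theta> + A\<^sub>q\<^sup>2 + A\<^sub>q * A\<^sub>y)"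
          using \<theta>_dissipation[OF sys, folded A_defs D\<^sub>1_def] lead[OF c\<^sub>0(2), of A\<^sub>\<theta>]
            le(1)[of "\<rho>\<^sub>3 * \<beta>" A\<^sub>q A\<^sub>\<theta>] le(2)[of \<tau> A\<^sub>q A\<^sub>q] le(1)[of "\<tau> * \<delta>" A\<^sub>q A\<^sub>y] A
          unfolding distrib_left by simp
        have D2_le: "D\<^sub>2 \<le> - c\<^sub>0 * A\<^sub>y\<^sup>2 + K * (A\<^sub>y * A\<^sub>\<eta> + A\<^sub>z * A\<^sub>\<eta> + A\<^sub>\<eta>\<^sup>2 + A\<^sub>v * A\<^sub>\<eta> + A\<^sub>\<theta> * A\<^sub>\<eta>)"
          using y_dissipation[OF sys, folded A_defs D\<^sub>2_def] lead[OF c\<^sub>0(3), of A\<^sub>y] le_\<eta>\<eta>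
            le_\<eta>[of \<rho>\<^sub>2 A\<^sub>y, OF _ _ R_le] le_\<eta>[of a A\<^sub>z, OF _ _ \<mu>_le] le_\<eta>[of k A\<^sub>v, OF _ _ \<mu>_le] le_\<eta>[of \<delta> A\<^sub>\<theta>, OF _ _ \<mu>_le] A
          unfolding distrib_left by simp
        have D3_le: "D\<^sub>3 \<le> - c\<^sub>0 * A\<^sub>v\<^sup>2 + K * (A\<^sub>y\<^sup>2 + A\<^sub>u * A\<^sub>y + A\<^sub>v * A\<^sub>\<eta> + A\<^sub>v * A\<^sub>\<theta>)"
          using v_dissipation[OF sys, folded A_defs D\<^sub>3_def] lead[OF c\<^sub>0(4), of A\<^sub>v]
            le(2)[of "k * \<rho>\<^sub>2" A\<^sub>y A\<^sub>y] le(1)[of "\<bar>a * \<rho>\<^sub>1 - k * \<rho>\<^sub>2\<bar>" A\<^sub>u A\<^sub>y]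
            le_\<eta>[of "k * m" A\<^sub>v, OF _ _ \<mu>_le] le(1)[of "k * \<delta>" A\<^sub>v A\<^sub>\<theta>] A
          unfolding distrib_left by simp
        have D4_le: "D\<^sub>4 \<le> - c\<^sub>0 * A\<^sub>u\<^sup>2 + K * (A\<^sub>u * A\<^sub>y + A\<^sub>v\<^sup>2)"
          using u_dissipation[OF sys, folded A_defs D\<^sub>4_def] lead[OF c\<^sub>0(5), of A\<^sub>u]
            le(1)[of \<rho>\<^sub>1 A\<^sub>u A\<^sub>y] le(2)[of k A\<^sub>v A\<^sub>v] A
          unfolding distrib_left by simp
        have D5_le: "D\<^sub>5 \<le> - c\<^sub>0 * A\<^sub>z\<^sup>2 + K * (A\<^sub>z * A\<^sub>\<eta> + A\<^sub>z * A\<^sub>v + A\<^sub>z * A\<^sub>\<theta> + A\<^sub>y\<^sup>2)"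
          using z_dissipation[OF sys, folded A_defs D\<^sub>5_def] lead[OF c\<^sub>0(6), of A\<^sub>z]
            le_\<eta>[of m A\<^sub>z, OF _ _ \<mu>_le] le(1)[of k A\<^sub>z A\<^sub>v] le(1)[of \<delta> A\<^sub>z A\<^sub>\<theta>] le(2)[of \<rho>\<^sub>2 A\<^sub>y A\<^sub>y] A
          unfolding distrib_left by simp
        \<comment> \<open>Dividing by \<open>c\<^sub>0\<close> normalises the leading coefficients
          to 1, which is why the absorption runs with \<open>K / c\<^sub>0\<close>.\<close>
        have scale: "D / c\<^sub>0 \<le> - X + K / c\<^sub>0 * Y" if "D \<le> - c\<^sub>0 * X + K * Y" for D X Y
          using divide_right_mono[OF that, of c\<^sub>0] c\<^sub>0(1) by (simp add: field_simps)
        have scale\<^sub>0: "D / c\<^sub>0 \<le> - X" if "D \<le> - c\<^sub>0 * X" for D X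
          using divide_right_mono[OF that, of c\<^sub>0] c\<^sub>0(1) by (simp add: field_simps)
        have "n\<^sub>0 * (D\<^sub>0 / c\<^sub>0) + n\<^sub>1 * (D\<^sub>1 / c\<^sub>0) + n\<^sub>2 * (D\<^sub>2 / c\<^sub>0) + n\<^sub>3 * (D\<^sub>3 / c\<^sub>0) + n\<^sub>4 * (D\<^sub>4 / c\<^sub>0) + n\<^sub>5 * (D\<^sub>5 / c\<^sub>0)
            \<le> - (A\<^sub>v\<^sup>2 + A\<^sub>u\<^sup>2 + A\<^sub>z\<^sup>2 + A\<^sub>y\<^sup>2 + A\<^sub>\<theta>\<^sup>2 + A\<^sub>q\<^sup>2 + A\<^sub>\<eta>\<^sup>2)"
          by (rule cascade[OF scale\<^sub>0[OF D0_le] scale[OF D1_le] scale[OF D2_le] scale[OF D3_le] scale[OF D4_le] scale[OF D5_le] n\<^sub>0(1)])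
        then have D: "n\<^sub>0 * D\<^sub>0 + (n\<^sub>1 * D\<^sub>1 + n\<^sub>2 * D\<^sub>2 + n\<^sub>3 * D\<^sub>3 + n\<^sub>4 * D\<^sub>4 + n\<^sub>5 * D\<^sub>5)
            \<le> - c\<^sub>0 * (A\<^sub>v\<^sup>2 + A\<^sub>u\<^sup>2 + A\<^sub>z\<^sup>2 + A\<^sub>y\<^sup>2 + A\<^sub>\<theta>\<^sup>2 + A\<^sub>q\<^sup>2 + A\<^sub>\<eta>\<^sup>2)"
          using c\<^sub>0(1) by (simp add: field_simps)

        have rS: "r * S t \<le> A\<^sub>v\<^sup>2 + A\<^sub>u\<^sup>2 + A\<^sub>z\<^sup>2 + A\<^sub>y\<^sup>2 + A\<^sub>\<theta>\<^sup>2 + A\<^sub>q\<^sup>2 + A\<^sub>\<eta>\<^sup>2"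
        proof -
          \<comment> \<open>\<open>w\<close> is the squared weight of a component and
            \<open>w'\<close> the monomial in \<open>p\<close> and \<open>\<sigma>\<close> that
            separates it from \<open>r\<close>.\<close>
          have r_le: "r * X \<le> w * X" if "w * w' = r" "0 \<le> w" "w' \<le> 1" "0 \<le> X" for w w' X
            using that mult_left_mono[of w' 1 w] by (intro mult_right_mono) auto
          have "r * (cmod (v t))\<^sup>2 \<le> A\<^sub>v\<^sup>2"
            unfolding A_defs power_mult_distrib
            by (rule r_le[of _ "p\<^sup>2"]) (use p01 in \<open>auto simp: r_def power2_eq_square power4_eq_xxxx\<close>)
          moreover have "r * (cmod (u t))\<^sup>2 = A\<^sub>u\<^sup>2"
            by (simp add: A_defs power_mult_distrib r_def)
          moreover have "r * (cmod (z t))\<^sup>2 \<le> A\<^sub>z\<^sup>2"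
            unfolding A_defs power_mult_distrib
            by (rule r_le[of _ "\<sigma>\<^sup>2"]) (use p01 in \<open>auto simp: r_def\<close>)
          moreover have p\<sigma>: "p\<^sup>2 * \<sigma>\<^sup>2 \<le> 1" "p ^ 4 * \<sigma>\<^sup>2 \<le> 1"
            using p01 power_le_one[of "p\<^sup>2" 2] by (auto intro!: mult_le_one)
          moreover have "r * (cmod (y t))\<^sup>2 \<le> A\<^sub>y\<^sup>2" "r * (cmod (\<theta> t))\<^sup>2 \<le> A\<^sub>\<theta>\<^sup>2"
            unfolding A_defs power_mult_distrib
            by (rule r_le[of _ "p\<^sup>2 * \<sigma>\<^sup>2"]; use p\<sigma> in \<open>auto simp: r_def power2_eq_square power4_eq_xxxx\<close>)+
          moreover have "r * (cmod (q t))\<^sup>2 \<le> A\<^sub>q\<^sup>2" "r * (\<xi>\<^sup>2 * N t) \<le> A\<^sub>\<eta>\<^sup>2"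
            using r_le[of 1 r "(cmod (q t))\<^sup>2"] r_le[of 1 r "\<xi>\<^sup>2 * N t"] p\<sigma>(2) hist(4)[OF t] A\<^sub>\<eta>(2)
            by (auto simp: r_def A_defs)
          ultimately show ?thesis unfolding S_def distrib_left by linarith
        qed
        have J_le: "\<bar>J t\<bar> \<le> n\<^sub>0 / 2 * E t"
        proof -
          have N: "0 \<le> \<xi>\<^sup>2 * N t" using hist(4)[OF t] by simp
          have S_ge: "cmod (q t) * cmod (\<theta> t) \<le> S t" "cmod (y t) * A\<^sub>\<eta> \<le> S t" "cmod (y t) * cmod (v t) \<le> S t"
            "cmod (u t) * cmod (z t) \<le> S t" "cmod (v t) * cmod (u t) \<le> S t" "cmod (y t) * cmod (z t) \<le> S t"
            unfolding S_def A\<^sub>\<eta>(2)[symmetric] by (rule order_trans[OF mult_le_sum_squares], simp)+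
          have "\<bar>n\<^sub>1 * (\<sigma>\<^sup>2 * (\<tau> * \<rho>\<^sub>3 * \<xi> * Im (q t * cnj (\<theta> t))))\<bar> \<le> n\<^sub>1 * (\<tau> * \<rho>\<^sub>3 * S t)"
            unfolding abs_mult_pos'[OF less_imp_le[OF n(1)], symmetric]
            using n pos by (intro mult_left_mono order_trans[OF multiplier_bounds(1)[OF sys]] S_ge) auto
          moreover have "\<bar>n\<^sub>2 * (p\<^sup>2 * (- \<rho>\<^sub>2 * Re (y t * cnj (\<mu> t))))\<bar> \<le> n\<^sub>2 * (\<rho>\<^sub>2 * \<kappa> * S t)"
          proof -
            have "cmod (y t) * (\<bar>\<xi>\<bar> * cmod (\<mu> t)) \<le> cmod (y t) * (\<kappa> * A\<^sub>\<eta>)"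
              by (intro mult_left_mono \<mu>_le) auto
            also have "\<dots> \<le> \<kappa> * S t" using mult_left_mono[OF S_ge(2) \<kappa>] by (simp add: mult_ac)
            finally have "\<rho>\<^sub>2 * (cmod (y t) * (\<bar>\<xi>\<bar> * cmod (\<mu> t))) \<le> \<rho>\<^sub>2 * \<kappa> * S t"
              unfolding mult.assoc using pos by (intro mult_left_mono) auto
            then show ?thesis
              unfolding abs_mult_pos'[OF less_imp_le[OF n(2)], symmetric]
              using n by (intro mult_left_mono order_trans[OF multiplier_bounds(2)[OF sys]]) auto
          qed
          moreover have "\<bar>n\<^sub>3 * (p\<^sup>2 * \<sigma>\<^sup>2 * (- k * \<rho>\<^sub>2 * Re (y t * cnj (v t)) - a * \<rho>\<^sub>1 * Re (u t * cnj (z t))))\<bar>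
              \<le> n\<^sub>3 * ((k * \<rho>\<^sub>2 + a * \<rho>\<^sub>1) * S t)"
            unfolding abs_mult_pos'[OF less_imp_le[OF n(3)], symmetric] distrib_right
            using n pos by (intro mult_left_mono order_trans[OF multiplier_bounds(3)[OF sys]] add_mono S_ge) auto
          moreover have "\<bar>n\<^sub>4 * (p\<^sup>2 * \<sigma>^4 * (- \<rho>\<^sub>1 * \<xi> * Im (v t * cnj (u t))))\<bar> \<le> n\<^sub>4 * (\<rho>\<^sub>1 * S t)"
            unfolding abs_mult_pos'[OF less_imp_le[OF n(4)], symmetric]
            using n pos by (intro mult_left_mono order_trans[OF multiplier_bounds(4)[OF sys]] S_ge) auto
          moreover have "\<bar>n\<^sub>5 * (p\<^sup>2 * \<sigma>\<^sup>2 * (- \<rho>\<^sub>2 * \<xi> * Im (y t * cnj (z t))))\<bar> \<le> n\<^sub>5 * (\<rho>\<^sub>2 * S t)"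
            unfolding abs_mult_pos'[OF less_imp_le[OF n(5)], symmetric]
            using n pos by (intro mult_left_mono order_trans[OF multiplier_bounds(5)[OF sys]] S_ge) auto
          ultimately have "\<bar>J t\<bar> \<le> n\<^sub>1 * (\<tau> * \<rho>\<^sub>3 * S t) + n\<^sub>2 * (\<rho>\<^sub>2 * \<kappa> * S t) + n\<^sub>3 * ((k * \<rho>\<^sub>2 + a * \<rho>\<^sub>1) * S t)
              + n\<^sub>4 * (\<rho>\<^sub>1 * S t) + n\<^sub>5 * (\<rho>\<^sub>2 * S t)"
            unfolding J_def by linarith
          also have "\<dots> = G * S t" by (simp add: G_def algebra_simps)
          also have "\<dots> \<le> n\<^sub>0 / 2 * e\<^sub>0 * S t"
            by (rule mult_right_mono[OF n\<^sub>0(3)]) (use N in \<open>simp add: S_def\<close>)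
          also have "\<dots> \<le> n\<^sub>0 / 2 * E t"
            unfolding mult.assoc[of _ e\<^sub>0] using E_S(1)[OF t] n\<^sub>0(2) by (intro mult_left_mono) auto
          finally show ?thesis .
        qed
        have "c * r * L t \<le> c\<^sub>0 * (r * S t)"
        proof -
          have "0 \<le> n\<^sub>0 / 2 * E t" using J_le by linarith
          then have "L t \<le> 2 * n\<^sub>0 * E t" using J_le unfolding L_def by linarith
          also have "\<dots> \<le> 2 * n\<^sub>0 * (e\<^sub>1 * S t)" using E_S(2)[OF t] n\<^sub>0(2) by (intro mult_left_mono) auto
          finally have "c * r * L t \<le> c * r * (2 * n\<^sub>0 * (e\<^sub>1 * S t))"
            using c r_nonneg by (intro mult_left_mono) auto
          also have "\<dots> = c\<^sub>0 * (r * S t)" using n\<^sub>0(2) e\<^sub>1_pos by (simp add: c_def)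
          finally show ?thesis .
        qed
        moreover have "c\<^sub>0 * (r * S t) \<le> c\<^sub>0 * (A\<^sub>v\<^sup>2 + A\<^sub>u\<^sup>2 + A\<^sub>z\<^sup>2 + A\<^sub>y\<^sup>2 + A\<^sub>\<theta>\<^sup>2 + A\<^sub>q\<^sup>2 + A\<^sub>\<eta>\<^sup>2)"
          using rS c\<^sub>0(1) by (intro mult_left_mono) auto
        ultimately show ?thesis using D dL J_le by (intro conjI exI[of _ "n\<^sub>0 * D\<^sub>0 + (n\<^sub>1 * D\<^sub>1 + n\<^sub>2 * D\<^sub>2 + n\<^sub>3 * D\<^sub>3 + n\<^sub>4 * D\<^sub>4 + n\<^sub>5 * D\<^sub>5)"]) auto
      qed

      \<comment> \<open>Conclusion from the decay of \<open>L\<close>\<close>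
      have J0: "\<bar>J 0\<bar> \<le> n\<^sub>0 * E 0 / 2" using key[of 0] by simp
      then have "0 \<le> n\<^sub>0 * E 0" by linarith
      \<comment> \<open>The sign of \<open>E 0\<close> is used when the rate \<open>r\<close> is
        replaced by the possibly smaller \<open>decay_rate\<close>.\<close>
      then have E0: "0 \<le> E 0" using n\<^sub>0(2) by (simp add: zero_le_mult_iff)
      have "n\<^sub>0 / 2 * E t \<le> L t" using key[OF t] unfolding L_def by linarith
      also have "L t \<le> L 0 * exp (- (c * r) * t)"
        by (rule exp_decay_of_deriv_le[OF _ t]) (use key in auto)
      also have "L 0 \<le> 2 * n\<^sub>0 * E 0" using J0 \<open>0 \<le> n\<^sub>0 * E 0\<close> unfolding L_def by linarith
      finally have "n\<^sub>0 / 2 * E t \<le> 2 * n\<^sub>0 * E 0 * exp (- (c * r) * t)" by simp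
      then have "E t \<le> 4 * exp (- (c * r) * t) * E 0" using n\<^sub>0(2) by (simp add: field_simps)
      also have "\<dots> \<le> 4 * exp (- c * decay_rate \<chi>\<^sub>0 \<xi> * t) * E 0"
      proof -
        have "c * decay_rate \<chi>\<^sub>0 \<xi> * t \<le> c * r * t"
          using rate c t by (intro mult_right_mono mult_left_mono) auto
        then show ?thesis using E0 by (intro mult_right_mono) auto
      qed
      finally show "timoshenko_cattaneo_energy \<rho>\<^sub>1 \<rho>\<^sub>2 \<rho>\<^sub>3 k a m \<tau> g \<xi> v u z y \<theta> q \<eta> t
                \<le> 4 * exp (- c * decay_rate \<chi>\<^sub>0 \<xi> * t)
                    * timoshenko_cattaneo_energy \<rho>\<^sub>1 \<rho>\<^sub>2 \<rho>\<^sub>3 k a m \<tau> g \<xi> v u z y \<theta> q \<eta> 0"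
        unfolding E_def .
    qed
  qed
qed

end
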